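(* For any automorphism $\phi$ of the Gupta-Sidki group one has $R(\phi)=\infty$.
   Context: Reidemeister numbers: for an automorphism $\phi$ of a group $G$, elements $x,y\in G$ are $\phi$-conjugate if $y=gx\phi(g^{-1})$ for some $g\in G$; $R(\phi)$ is the number of equivalence classes (Reidemeister classes). The Gupta-Sidki group is the group of automorphisms of the rooted ternary tree, whose vertices are the finite words over $\{0,1,2\}$, generated by $x$ and $\gamma$. Here $x$ cyclically permutes the three subtrees hanging from the root: $0s\mapsto 1s\mapsto 2s\mapsto 0s$ for every finite word $s$. The automorphism $\gamma$ is defined recursively by $\gamma=(\gamma,x,x^{-1})$, i.e. it fixes the three vertices of level $1$ and acts on the subtrees with roots $0,1,2$ as $\gamma$, $x$, $x^{-1}$ respectively (each subtree being identified with the whole tree by deleting the first letter). *)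

theory Defs
  imports "HOL-Algebra.Elementary_Groups" "HOL-Library.Extended_Nat"
begin

section \<open>Reidemeister numbers\<close>

definition twisted_conj ::
  "('a, 'b) monoid_scheme \<Rightarrow> ('a \<Rightarrow> 'a) \<Rightarrow> ('a \<times> 'a) set"
  where "twisted_conj G \<phi> =
    {(x, y). x \<in> carrier G \<and> y \<in> carrier G \<and>
      (\<exists>g\<in>carrier G. y = g \<otimes>\<^bsub>G\<^esub> x \<otimes>\<^bsub>G\<^esub> \<phi> (inv\<^bsub>G\<^esub> g))}"

definition reidemeister_classes ::
  "('a, 'b) monoid_scheme \<Rightarrow> ('a \<Rightarrow> 'a) \<Rightarrow> 'a set set"
  where "reidemeister_classes G \<phi> = carrier G // twisted_conj G \<phi>"

definition reidemeister_number ::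
  "('a, 'b) monoid_scheme \<Rightarrow> ('a \<Rightarrow> 'a) \<Rightarrow> enat"
  where "reidemeister_number G \<phi> =
    (if finite (reidemeister_classes G \<phi>)
     then enat (card (reidemeister_classes G \<phi>)) else \<infinity>)"

lemma equiv_twisted_conj:
  assumes "group G" and "\<phi> \<in> hom G G"
  shows "equiv (carrier G) (twisted_conj G \<phi>)"
proof -
  interpret group G by fact
  interpret group_hom G G \<phi>
    using assms by (simp add: group_hom_def group_hom_axioms_def)
  show ?thesis
  proof (rule equivI)
    show "twisted_conj G \<phi> \<subseteq> carrier G \<times> carrier G"
      by (auto simp: twisted_conj_def)
    show "refl_on (carrier G) (twisted_conj G \<phi>)"
      by (auto simp: refl_on_def twisted_conj_def intro!: bexI[of _ "\<one>\<^bsub>G\<^esub>"])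
    show "sym (twisted_conj G \<phi>)"
    proof (rule symI)
      fix x y assume "(x, y) \<in> twisted_conj G \<phi>"
      then obtain g where g: "x \<in> carrier G" "y \<in> carrier G" "g \<in> carrier G"
        "y = g \<otimes>\<^bsub>G\<^esub> x \<otimes>\<^bsub>G\<^esub> \<phi> (inv\<^bsub>G\<^esub> g)"
        by (auto simp: twisted_conj_def)
      have c: "inv\<^bsub>G\<^esub> g \<otimes>\<^bsub>G\<^esub> (g \<otimes>\<^bsub>G\<^esub> z) = z" if "z \<in> carrier G" for z
        using g(3) that by (simp flip: m_assoc)
      have "\<phi> (inv\<^bsub>G\<^esub> g) \<otimes>\<^bsub>G\<^esub> \<phi> g = \<one>\<^bsub>G\<^esub>"
        using g(3) by simp
      then have "inv\<^bsub>G\<^esub> g \<otimes>\<^bsub>G\<^esub> y \<otimes>\<^bsub>G\<^esub> \<phi> (inv\<^bsub>G\<^esub> (inv\<^bsub>G\<^esub> g)) = x"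
        using g by (simp add: m_assoc c del: hom_inv)
      then show "(y, x) \<in> twisted_conj G \<phi>"
        using g unfolding twisted_conj_def
        by (auto intro!: bexI[of _ "inv\<^bsub>G\<^esub> g"])
    qed
    show "trans (twisted_conj G \<phi>)"
    proof (rule transI)
      fix x y z
      assume "(x, y) \<in> twisted_conj G \<phi>" "(y, z) \<in> twisted_conj G \<phi>"
      then obtain g h where g: "x \<in> carrier G" "z \<in> carrier G" "g \<in> carrier G" "h \<in> carrier G"
        "z = h \<otimes>\<^bsub>G\<^esub> (g \<otimes>\<^bsub>G\<^esub> x \<otimes>\<^bsub>G\<^esub> \<phi> (inv\<^bsub>G\<^esub> g)) \<otimes>\<^bsub>G\<^esub> \<phi> (inv\<^bsub>G\<^esub> h)"
        by (auto simp: twisted_conj_def)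
      have "z = (h \<otimes>\<^bsub>G\<^esub> g) \<otimes>\<^bsub>G\<^esub> x \<otimes>\<^bsub>G\<^esub> \<phi> (inv\<^bsub>G\<^esub> (h \<otimes>\<^bsub>G\<^esub> g))"
        using g by (simp add: m_assoc inv_mult_group)
      then show "(x, z) \<in> twisted_conj G \<phi>"
        using g unfolding twisted_conj_def
        by (auto intro!: bexI[of _ "h \<otimes>\<^bsub>G\<^esub> g"])
    qed
  qed
qed

section \<open>Automorphisms of the rooted ternary tree\<close>

datatype letter = L0 | L1 | L2

text \<open>The vertices are the finite words, the root is the empty word, and the
  children of \<open>u\<close> are the words \<open>u @ [c]\<close>.\<close>

definition tree_adj :: "letter list \<Rightarrow> letter list \<Rightarrow> bool"
  where "tree_adj u v \<longleftrightarrow> (\<exists>c. v = u @ [c] \<or> u = v @ [c])"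

definition tree_automorphism :: "(letter list \<Rightarrow> letter list) \<Rightarrow> bool"
  where "tree_automorphism f \<longleftrightarrow>
    bij f \<and> f [] = [] \<and> (\<forall>u v. tree_adj (f u) (f v) \<longleftrightarrow> tree_adj u v)"

text \<open>Automorphisms act from the left. Acting from the right would give the opposite
  group, in which twisted conjugacy has the same classes up to inversion of elements.\<close>

definition tree_Aut :: "(letter list \<Rightarrow> letter list) monoid"
  where "tree_Aut = \<lparr>carrier = Collect tree_automorphism, mult = (\<circ>), one = id\<rparr>"

lemma tree_automorphism_inv:
  assumes "tree_automorphism f"
  shows "tree_automorphism (inv_into UNIV f)"
proof -
  have f: "bij f" "f [] = []" "\<And>u v. tree_adj (f u) (f v) \<longleftrightarrow> tree_adj u v"
    using assms by (auto simp: tree_automorphism_def)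
  have s: "f (inv_into UNIV f u) = u" for u
    using f(1) by (simp add: bij_is_surj surj_f_inv_f)
  show ?thesis unfolding tree_automorphism_def
  proof (intro conjI allI)
    show "bij (inv_into UNIV f)" using f(1) by (rule bij_imp_bij_inv)
    show "inv_into UNIV f [] = []"
      using f(1,2) by (metis bij_is_inj inv_f_f)
    show "tree_adj (inv_into UNIV f u) (inv_into UNIV f v) \<longleftrightarrow> tree_adj u v" for u v
      using f(3)[of "inv_into UNIV f u" "inv_into UNIV f v"] by (simp add: s)
  qed
qed

lemma group_tree_Aut: "group tree_Aut"
proof (rule groupI)
  fix f assume f: "f \<in> carrier tree_Aut"
  then have "bij f" by (simp add: tree_Aut_def tree_automorphism_def)
  then have "inv_into UNIV f \<circ> f = id" by (simp add: bij_is_inj)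
  then show "\<exists>g\<in>carrier tree_Aut. g \<otimes>\<^bsub>tree_Aut\<^esub> f = \<one>\<^bsub>tree_Aut\<^esub>"
    using f tree_automorphism_inv[of f] by (auto simp: tree_Aut_def)
qed (auto simp: tree_Aut_def tree_automorphism_def bij_comp)

lemma inv_tree_Aut:
  assumes "f \<in> carrier tree_Aut"
  shows "inv\<^bsub>tree_Aut\<^esub> f = inv_into UNIV f"
proof (rule group.inv_equality[OF group_tree_Aut _ assms])
  have "bij f" "tree_automorphism f"
    using assms by (auto simp: tree_Aut_def tree_automorphism_def)
  then show "inv_into UNIV f \<otimes>\<^bsub>tree_Aut\<^esub> f = \<one>\<^bsub>tree_Aut\<^esub>"
    "inv_into UNIV f \<in> carrier tree_Aut"
    using tree_automorphism_inv[of f] by (auto simp: tree_Aut_def bij_is_inj)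
qed

section \<open>The Gupta-Sidki group\<close>

fun gs_x :: "letter list \<Rightarrow> letter list" where
  "gs_x [] = []"
| "gs_x (L0 # s) = L1 # s"
| "gs_x (L1 # s) = L2 # s"
| "gs_x (L2 # s) = L0 # s"

fun gs_gamma :: "letter list \<Rightarrow> letter list" where
  "gs_gamma [] = []"
| "gs_gamma (L0 # s) = L0 # gs_gamma s"
| "gs_gamma (L1 # s) = L1 # gs_x s"
| "gs_gamma (L2 # s) = L2 # (inv\<^bsub>tree_Aut\<^esub> gs_x) s"

definition gupta_sidki :: "(letter list \<Rightarrow> letter list) monoid"
  where "gupta_sidki = subgroup_generated tree_Aut {gs_x, gs_gamma}"

text \<open>\<^const>\<open>subgroup_generated\<close> silently discards generators outside the carrier,
  so both generators have to be tree automorphisms.\<close>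

lemma tree_adj_simps [simp]:
  "tree_adj [] v \<longleftrightarrow> (\<exists>c. v = [c])"
  "tree_adj u [] \<longleftrightarrow> (\<exists>c. u = [c])"
  "tree_adj (a # u) (b # v) \<longleftrightarrow> a = b \<and> tree_adj u v"
  by (auto simp: tree_adj_def Cons_eq_append_conv append_eq_Cons_conv)

lemma gs_x_cube: "gs_x (gs_x (gs_x w)) = w"
  by (cases w rule: gs_x.cases) auto

lemma bij_gs_x: "bij gs_x"
  by (rule o_bij[of "gs_x \<circ> gs_x"]) (auto simp: gs_x_cube fun_eq_iff)

lemma gs_x_Cons: "gs_x (a # s) = (case a of L0 \<Rightarrow> L1 | L1 \<Rightarrow> L2 | L2 \<Rightarrow> L0) # s"
  by (cases a) auto

lemma gs_x_tree_Aut: "gs_x \<in> carrier tree_Aut"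
proof -
  have "tree_adj (gs_x u) (gs_x v) \<longleftrightarrow> tree_adj u v" for u v
    by (cases u; cases v) (auto simp: gs_x_Cons split: letter.splits)
  then show ?thesis
    by (simp add: tree_Aut_def tree_automorphism_def bij_gs_x)
qed

lemma inv_gs_x: "inv\<^bsub>tree_Aut\<^esub> gs_x = gs_x \<circ> gs_x"
proof -
  have "inv_into UNIV gs_x = gs_x \<circ> gs_x"
    by (rule inv_equality) (auto simp: gs_x_cube)
  then show ?thesis by (simp add: inv_tree_Aut gs_x_tree_Aut)
qed

lemma gs_gamma_cube: "gs_gamma (gs_gamma (gs_gamma w)) = w"
  by (induction w rule: gs_gamma.induct) (auto simp: inv_gs_x gs_x_cube)

lemma bij_gs_gamma: "bij gs_gamma"
  by (rule o_bij[of "gs_gamma \<circ> gs_gamma"]) (auto simp: gs_gamma_cube fun_eq_iff)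

lemma gs_x_eq_Nil [simp]: "gs_x u = [] \<longleftrightarrow> u = []"
  by (cases u rule: gs_x.cases) auto

lemma gs_gamma_eq_Nil [simp]: "gs_gamma u = [] \<longleftrightarrow> u = []"
  by (cases u rule: gs_gamma.cases) auto

lemma gs_gamma_tree_Aut: "gs_gamma \<in> carrier tree_Aut"
proof -
  have x: "tree_adj (gs_x u) (gs_x v) \<longleftrightarrow> tree_adj u v" for u v
    using gs_x_tree_Aut by (simp add: tree_Aut_def tree_automorphism_def)
  have single: "(\<exists>c. gs_gamma v = [c]) \<longleftrightarrow> (\<exists>c. v = [c])" for v
    by (cases v rule: gs_gamma.cases) (auto simp: inv_gs_x)
  have "tree_adj (gs_gamma u) (gs_gamma v) \<longleftrightarrow> tree_adj u v" for u v
  proof (induction u arbitrary: v rule: gs_gamma.induct)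
    case 1 then show ?case by (simp add: single)
  next
    case (2 s) then show ?case
      by (cases v rule: gs_gamma.cases) (auto simp: inv_gs_x)
  next
    case (3 s) then show ?case
      by (cases v rule: gs_gamma.cases) (auto simp: inv_gs_x x)
  next
    case (4 s) then show ?case
      by (cases v rule: gs_gamma.cases) (auto simp: inv_gs_x x)
  qed
  then show ?thesis
    by (simp add: tree_Aut_def tree_automorphism_def bij_gs_gamma)
qed

lemma carrier_gupta_sidki: "carrier gupta_sidki = generate tree_Aut {gs_x, gs_gamma}"
proof -
  have "carrier tree_Aut \<inter> {gs_x, gs_gamma} = {gs_x, gs_gamma}"
    using gs_x_tree_Aut gs_gamma_tree_Aut by blast
  then show ?thesis
    by (simp add: gupta_sidki_def carrier_subgroup_generated)
qed

lemma group_gupta_sidki: "group gupta_sidki"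
  unfolding gupta_sidki_def
  by (rule group.group_subgroup_generated[OF group_tree_Aut])

end

theory Submission
  imports Defs
begin

text \<open>
  Write \<open>G\<close> for the Gupta-Sidki group, generated by \<open>x\<close> and \<open>\<gamma>\<close>.

  \<^bold>\<open>From twisted to ordinary conjugacy.\<close> Every automorphism \<open>\<phi>\<close> of \<open>G\<close> is conjugation by some
  automorphism \<open>t\<close> of the tree (\<open>aut_is_conjugation\<close>). Then \<open>y = g a \<phi>(g\<inverse>)\<close> says the same as
  \<open>y t = g (a t) g\<inverse>\<close>, so the Reidemeister classes of \<open>\<phi>\<close> are the classes of the coset \<open>G t\<close> under
  conjugation by \<open>G\<close>. It is enough to find an invariant of conjugacy of tree automorphisms that takes
  infinitely many values on \<open>G t\<close> (\<open>reidemeister_infinite\<close>). The invariant is the depth to which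
  an automorphism fixes vertices, or a variant of it.

  \<^bold>\<open>Why automorphisms come from the tree.\<close> In \<open>G\<close> a nontrivial normal subgroup has trivial
  centralizer, and the same holds in every subgroup that contains the derived subgroup \<open>G'\<close> and moves
  the first level (\<open>centralizer_trivial\<close>). The stabilizer \<open>B\<close> of the first level, on the other hand, has
  three nontrivial normal subgroups that commute with each other, the rigid stabilizers of the three
  vertices. Hence \<open>\<phi>(B) = B\<close> (\<open>aut_stab\<close>). The image of a rigid stabilizer has sections which form
  normal subgroups of \<open>G\<close>, and those of different rigid stabilizers commute; so \<open>\<phi>\<close> permutes the rigid
  stabilizers (\<open>aut_permutes_rist\<close>), which gives the action of \<open>t\<close> on the first level. Taking
  centralizers of rigid stabilizers, one sees that \<open>\<phi>\<close> induces automorphisms of the three coordinate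
  copies of \<open>G\<close> (\<open>aut_section_aut\<close>), which give \<open>t\<close> on the subtrees by recursion.

  \<^bold>\<open>How freely sections can be prescribed.\<close> The alphabet is treated as the field with three elements,
  so that \<open>x\<close> is \<open>c \<mapsto> c + 1\<close> on the first level. The abelianization of \<open>G\<close> is measured by two exponents
  with values in this field, \<open>xexp\<close> and \<open>gexp\<close>, and \<open>G'\<close> is their common kernel. A triple of elements
  of \<open>G\<close> is the triple of sections of an element of \<open>B\<close> if and only if
  \<open>xexp y\<^sub>c = gexp y\<^sub>c\<^sub>-\<^sub>1 - gexp y\<^sub>c\<^sub>+\<^sub>1\<close> for every \<open>c\<close> (\<open>xexp_sec\<close>, \<open>branch_GS\<close>). This turns all questions
  about prescribed sections into linear algebra over the field with three elements.

  \<^bold>\<open>The depth of fixed vertices.\<close> Modulo \<open>G'\<close>, conjugation by \<open>t\<close> multiplies \<open>xexp\<close> and \<open>gexp\<close> by signs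
  \<open>xsign t\<close> and \<open>gsign t\<close>, and \<open>xsign t\<close> is also the sign of \<open>t\<close> as a permutation of the first level.
  The sections of \<open>t\<close> all have the same \<open>gsign\<close> as \<open>t\<close> and the same \<open>xsign\<close>, the product of both signs
  of \<open>t\<close> (\<open>sec_signs\<close>). So there are three types of sequences of signs of \<open>t\<close>, of its sections, of
  their sections, and so on:

  \<^item> always even (\<open>fixes_to_even\<close>): inductively, an element \<open>a\<close> of \<open>G\<close> can be chosen such that \<open>a t\<close> fixes the
    first level, has a section at one vertex that fixes vertices exactly to depth \<open>n\<close>, and moves all
    children of the other two vertices;
  \<^item> alternating (\<open>fixes_to_alternating\<close>, \<open>fixes_to_reflect\<close>): an odd permutation of the first level
    fixes exactly one vertex, where the section can be chosen freely; at an even step one can choose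
    all three sections to have the same depth, which thus grows in steps of two;
  \<^item> always odd (\<open>swaps_to_exists\<close>): now every element of \<open>G t\<close> fixes vertices on all levels, but its square
    has sections of the always even type at the two vertices that are swapped, and their depth
    serves as the invariant.
\<close>

section \<open>The alphabet as the field with three elements\<close>

instantiation letter :: comm_ring_1
begin

definition zero_letter :: letter where "zero_letter = L0"
definition one_letter :: letter where "one_letter = L1"
definition uminus_letter :: "letter \<Rightarrow> letter" where
  "uminus_letter a = (case a of L0 \<Rightarrow> L0 | L1 \<Rightarrow> L2 | L2 \<Rightarrow> L1)"
definition plus_letter :: "letter \<Rightarrow> letter \<Rightarrow> letter" where
  "plus_letter a b = (case a of L0 \<Rightarrow> b
     | L1 \<Rightarrow> (case b of L0 \<Rightarrow> L1 | L1 \<Rightarrow> L2 | L2 \<Rightarrow> L0)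
     | L2 \<Rightarrow> (case b of L0 \<Rightarrow> L2 | L1 \<Rightarrow> L0 | L2 \<Rightarrow> L1))"
definition minus_letter :: "letter \<Rightarrow> letter \<Rightarrow> letter" where
  "minus_letter a b = a + - b"
definition times_letter :: "letter \<Rightarrow> letter \<Rightarrow> letter" where
  "times_letter a b = (case a of L0 \<Rightarrow> L0 | L1 \<Rightarrow> b | L2 \<Rightarrow> - b)"

lemmas letter_defs = zero_letter_def one_letter_def uminus_letter_def plus_letter_def
  minus_letter_def times_letter_def

instance
proof
  fix a b c :: letter
  show "a + b + c = a + (b + c)"
    by (cases a; cases b; cases c) (simp_all add: letter_defs)
  show "a + b = b + a" by (cases a; cases b) (simp_all add: letter_defs)
  show "0 + a = a" by (cases a) (simp_all add: letter_defs)
  show "- a + a = 0" by (cases a) (simp_all add: letter_defs)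
  show "a - b = a + - b" by (simp add: minus_letter_def)
  show "a * b * c = a * (b * c)"
    by (cases a; cases b; cases c) (simp_all add: letter_defs)
  show "a * b = b * a" by (cases a; cases b) (simp_all add: letter_defs)
  show "1 * a = a" by (cases a) (simp_all add: letter_defs)
  show "(a + b) * c = a * c + b * c"
    by (cases a; cases b; cases c) (simp_all add: letter_defs)
  show "(0::letter) \<noteq> 1" by (simp add: letter_defs)
qed

end

lemma letter_cases: "c = 0 \<or> c = 1 \<or> c = (-1 :: letter)"
  by (cases c) (simp_all add: letter_defs)

lemma letter_distinct: "(1::letter) \<noteq> -1" "(-1::letter) \<noteq> 1" "(-1::letter) \<noteq> 0" "(0::letter) \<noteq> -1"
  by (simp_all add: letter_defs)

lemma letter_double: "c + c = - (c :: letter)" and letter_double': "- c - c = (c :: letter)"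
  by (cases c; simp add: letter_defs)+

lemma letter_numeral [simp]: "(2::letter) = -1" "(3::letter) = 0"
proof -
  show two: "(2::letter) = -1" using letter_double[of 1] by simp
  have "(3::letter) = 2 + 1" by simp
  then show "(3::letter) = 0" unfolding two by simp
qed

lemma finite_letter: "finite (UNIV :: letter set)"
proof -
  have "(UNIV :: letter set) = {L0, L1, L2}" using letter.exhaust by blast
  then show ?thesis by (metis finite.emptyI finite_insert)
qed

section \<open>Root maps and sections of tree automorphisms\<close>

text \<open>The symbol for converse relations is freed for inverse maps.\<close>

no_notation Relation.converse ("(_\<inverse>)" [1000] 999)

abbreviation bwd :: "('a \<Rightarrow> 'b) \<Rightarrow> 'b \<Rightarrow> 'a"  ("(_\<inverse>)" [1000] 1000)
  where "f\<inverse> \<equiv> inv_into UNIV f"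

abbreviation ta :: "(letter list \<Rightarrow> letter list) \<Rightarrow> bool" where "ta \<equiv> tree_automorphism"

lemma ta_bij: "ta f \<Longrightarrow> bij f"
  and ta_Nil [simp]: "ta f \<Longrightarrow> f [] = []"
  by (auto simp: tree_automorphism_def)

lemma ta_id [simp]: "ta id"
  by (auto simp: tree_automorphism_def)

lemma ta_comp [simp]: "ta f \<Longrightarrow> ta g \<Longrightarrow> ta (f \<circ> g)"
  by (auto simp: tree_automorphism_def bij_comp)

lemma ta_inv [simp]: "ta f \<Longrightarrow> ta (f\<inverse>)"
  by (rule tree_automorphism_inv)

lemma ta_inv_apply [simp]: "ta f \<Longrightarrow> f\<inverse> (f w) = w" "ta f \<Longrightarrow> f (f\<inverse> w) = w"
  by (simp_all add: ta_bij bij_is_inj bij_is_surj surj_f_inv_f)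

lemma ta_inv_cancel [simp]:
  "ta f \<Longrightarrow> f\<inverse> \<circ> f = id" "ta f \<Longrightarrow> f \<circ> f\<inverse> = id"
  "ta f \<Longrightarrow> f\<inverse> \<circ> (f \<circ> g) = g" "ta f \<Longrightarrow> f \<circ> (f\<inverse> \<circ> g) = g"
  by (simp_all add: fun_eq_iff)

lemma ta_inj: "ta f \<Longrightarrow> f u = f v \<longleftrightarrow> u = v"
  by (metis ta_inv_apply(1))

lemma ta_inv_comp: "ta f \<Longrightarrow> ta g \<Longrightarrow> (f \<circ> g)\<inverse> = g\<inverse> \<circ> f\<inverse>"
  by (simp add: o_inv_distrib ta_bij)

lemma ta_inv_inv [simp]: "ta f \<Longrightarrow> (f\<inverse>)\<inverse> = f"
  by (simp add: inv_inv_eq ta_bij)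

lemma ta_inverse_unique: "ta f \<Longrightarrow> f \<circ> g = id \<Longrightarrow> f\<inverse> = g"
  by (metis comp_id ta_inv_cancel(3))

text \<open>The tree is given by its adjacency relation only, so it has to be shown that automorphisms fixing the
root preserve levels and prefixes. A vertex has exactly one neighbour above it, and by injectivity
\<open>f (u @ [c])\<close> cannot be the image of the parent of \<open>u\<close>; this leaves only a child of \<open>f u\<close>.\<close>

lemma ta_length_snoc:
  assumes f: "ta f"
  shows "length (f w) = length w \<and> (\<forall>u c. w = u @ [c] \<longrightarrow> (\<exists>d. f w = f u @ [d]))"
proof (induction w rule: rev_induct)
  case Nil then show ?case using f by simp
next
  case (snoc c u)
  have "tree_adj u (u @ [c])" by (simp add: tree_adj_def)
  then have "tree_adj (f u) (f (u @ [c]))"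
    using f by (simp add: tree_automorphism_def)
  then consider d where "f (u @ [c]) = f u @ [d]" | d where "f u = f (u @ [c]) @ [d]"
    by (auto simp: tree_adj_def)
  then show ?case
  proof cases
    case 1 then show ?thesis using snoc by auto
  next
    case 2
    then have "u \<noteq> []" using f by auto
    then obtain u' e where u: "u = u' @ [e]" by (metis rev_exhaust)
    with snoc obtain e' where "f u = f u' @ [e']" by auto
    with 2 have "f (u @ [c]) = f u'" by simp
    then have "u @ [c] = u'" by (simp add: ta_inj[OF f])
    with u show ?thesis by simp
  qed
qed

lemma ta_length [simp]: "ta f \<Longrightarrow> length (f w) = length w"
  using ta_length_snoc by blast

text \<open>Every tree automorphism splits into a permutation \<open>rt f\<close> of the first level and three tree
automorphisms \<open>sec f c\<close>, where \<open>sec f c\<close> describes the map from the subtree below \<open>c\<close> to the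
subtree below \<open>rt f c\<close>.\<close>

definition rt :: "(letter list \<Rightarrow> letter list) \<Rightarrow> letter \<Rightarrow> letter"
  where "rt f c = hd (f [c])"

definition sec :: "(letter list \<Rightarrow> letter list) \<Rightarrow> letter \<Rightarrow> letter list \<Rightarrow> letter list"
  where "sec f c s = tl (f (c # s))"

lemma ta_Cons:
  assumes f: "ta f"
  shows "f (c # s) = rt f c # sec f c s"
proof -
  have "hd (f (c # s)) = rt f c"
  proof (induction s rule: rev_induct)
    case Nil show ?case by (simp add: rt_def)
  next
    case (snoc d s)
    obtain e where "f ((c # s) @ [d]) = f (c # s) @ [e]"
      using ta_length_snoc[OF f] by blast
    moreover have "f (c # s) \<noteq> []" using ta_length[OF f, of "c # s"] by auto
    ultimately show ?case using snoc by simp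
  qed
  moreover have "f (c # s) \<noteq> []" using ta_length[OF f, of "c # s"] by auto
  ultimately show ?thesis by (metis list.collapse sec_def)
qed

lemma rt_sec_unique:
  assumes "\<And>s. f (c # s) = d # h s"
  shows "rt f c = d" "sec f c = h"
  using assms by (auto simp: rt_def sec_def)

lemma ta_single: "ta f \<Longrightarrow> f [c] = [rt f c]"
  using ta_length[of f "[c]"] by (simp add: ta_Cons)

lemma rt_inj: "ta f \<Longrightarrow> rt f c = rt f d \<longleftrightarrow> c = d"
  using ta_inj[of f "[c]" "[d]"] by (auto simp: ta_single)

lemma ta_sec [simp]:
  assumes f: "ta f"
  shows "ta (sec f c)"
  unfolding tree_automorphism_def
proof (intro conjI allI)
  have len: "length (sec f c s) = length s" for s
    using ta_length[OF f, of "c # s"] by (simp add: ta_Cons[OF f])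
  show "sec f c [] = []" using len[of "[]"] by simp
  show "tree_adj (sec f c u) (sec f c v) \<longleftrightarrow> tree_adj u v" for u v
  proof -
    have "tree_adj (f (c # u)) (f (c # v)) \<longleftrightarrow> tree_adj (c # u) (c # v)"
      using f by (simp add: tree_automorphism_def)
    then show ?thesis by (simp add: ta_Cons[OF f])
  qed
  show "bij (sec f c)"
  proof (rule bijI)
    show "inj (sec f c)"
      using ta_inj[OF f, of "c # _" "c # _"] by (auto intro!: injI simp: ta_Cons[OF f])
    show "surj (sec f c)"
      unfolding surj_def
    proof
      fix w
      obtain v where v: "f v = rt f c # w" using f by (metis ta_inv_apply(2))
      then have "v \<noteq> []" using f by auto
      then obtain d s where "v = d # s" by (cases v) auto
      with v have "rt f d = rt f c" "sec f d s = w" by (simp_all add: ta_Cons[OF f])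
      then show "\<exists>s. w = sec f c s" using f by (auto simp: rt_inj)
    qed
  qed
qed

lemma rt_id [simp]: "rt id c = c" and sec_id [simp]: "sec id c = id"
  by (auto simp: rt_def sec_def fun_eq_iff)

lemma rt_comp [simp]: "ta f \<Longrightarrow> ta g \<Longrightarrow> rt (f \<circ> g) c = rt f (rt g c)"
  and sec_comp [simp]: "ta f \<Longrightarrow> ta g \<Longrightarrow> sec (f \<circ> g) c = sec f (rt g c) \<circ> sec g c"
  by (rule rt_sec_unique; simp add: ta_Cons)+

lemma rt_inv_rt [simp]: "ta f \<Longrightarrow> rt (f\<inverse>) (rt f c) = c"
  and rt_rt_inv [simp]: "ta f \<Longrightarrow> rt f (rt (f\<inverse>) c) = c"
  by (metis rt_comp rt_id ta_inv ta_inv_cancel(1,2))+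

lemma sec_inv:
  assumes "ta f" shows "sec (f\<inverse>) c = (sec f (rt (f\<inverse>) c))\<inverse>"
proof -
  have "sec f (rt (f\<inverse>) c) \<circ> sec (f\<inverse>) c = id"
    using assms sec_comp[of f "f\<inverse>" c] by (simp del: sec_comp)
  then show ?thesis using assms by (simp add: ta_inverse_unique)
qed

lemma sec_inv_rt [simp]: "ta f \<Longrightarrow> sec (f\<inverse>) (rt f c) = (sec f c)\<inverse>"
  by (simp add: sec_inv)

lemma ta_eqI:
  assumes "ta f" "ta g" "\<And>c. rt f c = rt g c" "\<And>c. sec f c = sec g c"
  shows "f = g"
proof
  fix w show "f w = g w" using assms by (cases w) (simp_all add: ta_Cons)
qed

lemma ta_append_move:
  assumes f: "ta f"
  shows "f u \<noteq> u \<Longrightarrow> f (u @ v) \<noteq> u @ v"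
proof (induction v rule: rev_induct)
  case (snoc c v)
  obtain d where "f ((u @ v) @ [c]) = f (u @ v) @ [d]"
    using ta_length_snoc[OF f] by blast
  then show ?case using snoc by auto
qed simp

primrec branch :: "(letter \<Rightarrow> letter list \<Rightarrow> letter list) \<Rightarrow> letter list \<Rightarrow> letter list" where
  "branch F [] = []"
| "branch F (c # s) = c # F c s"

lemma rt_branch [simp]: "rt (branch F) c = c" and sec_branch [simp]: "sec (branch F) c = F c"
  by (auto simp: rt_def sec_def)

lemma branch_comp: "branch F \<circ> branch H = branch (\<lambda>c. F c \<circ> H c)"
proof
  fix w show "(branch F \<circ> branch H) w = branch (\<lambda>c. F c \<circ> H c) w" by (cases w) auto
qed

lemma branch_id [simp]: "branch (\<lambda>c. id) = id"
proof
  fix w show "branch (\<lambda>c. id) w = id w" by (cases w) auto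
qed

lemma ta_branch [simp]:
  assumes F: "\<And>c. ta (F c)"
  shows "ta (branch F)"
  unfolding tree_automorphism_def
proof (intro conjI allI)
  have "branch F \<circ> branch (\<lambda>c. (F c)\<inverse>) = id" "branch (\<lambda>c. (F c)\<inverse>) \<circ> branch F = id"
    by (simp_all add: branch_comp F)
  then show "bij (branch F)" by (metis o_bij)
  have "F c s = [] \<longleftrightarrow> s = []" for c s
    using ta_length[OF F, of c s] by (metis length_0_conv)
  then have single: "(\<exists>c. branch F v = [c]) \<longleftrightarrow> (\<exists>c. v = [c])" for v
    by (cases v) auto
  show "tree_adj (branch F u) (branch F v) \<longleftrightarrow> tree_adj u v" for u v
    using F by (cases u; cases v) (auto simp: tree_automorphism_def single[of "_ # _", simplified])
qed simp

lemma branch_inv: "(\<And>c. ta (F c)) \<Longrightarrow> (branch F)\<inverse> = branch (\<lambda>c. (F c)\<inverse>)"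
  by (rule ta_inverse_unique) (simp_all add: branch_comp)

section \<open>The Gupta-Sidki group and its abelianization\<close>

text \<open>From here on, group elements are multiplied and not evaluated: the simplifier must leave \<open>f \<circ> g\<close>
intact so that the cancellation rules and the rules for sections apply.\<close>

declare comp_apply [simp del] id_apply [simp del]

abbreviation GS :: "(letter list \<Rightarrow> letter list) set" where "GS \<equiv> carrier gupta_sidki"

lemma ta_inv_tree_Aut: "ta f \<Longrightarrow> inv\<^bsub>tree_Aut\<^esub> f = f\<inverse>"
  by (rule inv_tree_Aut) (simp add: tree_Aut_def)

lemma GS_ta [simp]: "f \<in> GS \<Longrightarrow> ta f"
  using group.carrier_subgroup_generated_subset[OF group_tree_Aut]
  by (auto simp: gupta_sidki_def tree_Aut_def)

lemma ta_gens [simp]: "ta gs_x" "ta gs_gamma"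
  using gs_x_tree_Aut gs_gamma_tree_Aut by (simp_all add: tree_Aut_def)

lemma GS_mult [simp]: "f \<otimes>\<^bsub>gupta_sidki\<^esub> g = f \<circ> g"
  and GS_one [simp]: "\<one>\<^bsub>gupta_sidki\<^esub> = id"
  by (simp_all add: gupta_sidki_def tree_Aut_def)

lemma GS_inv_eq [simp]: "f \<in> GS \<Longrightarrow> inv\<^bsub>gupta_sidki\<^esub> f = f\<inverse>"
  using group.inv_subgroup_generated[OF group_tree_Aut, of f "{gs_x, gs_gamma}"]
    ta_inv_tree_Aut[OF GS_ta] by (simp add: gupta_sidki_def)

lemma GS_closed [simp]:
  shows GS_id: "id \<in> GS"
    and GS_comp: "f \<in> GS \<Longrightarrow> g \<in> GS \<Longrightarrow> f \<circ> g \<in> GS"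
    and GS_inv: "f \<in> GS \<Longrightarrow> f\<inverse> \<in> GS"
  using group.is_monoid[OF group_gupta_sidki, THEN monoid.one_closed]
    group.is_monoid[OF group_gupta_sidki, THEN monoid.m_closed]
    group.inv_closed[OF group_gupta_sidki, of f] by simp_all

lemma GS_gens [simp]: "gs_x \<in> GS" "gs_gamma \<in> GS"
  by (auto simp: carrier_gupta_sidki intro: generate.incl)

lemma gs_x_inv: "gs_x\<inverse> = gs_x \<circ> gs_x" and gs_gamma_inv: "gs_gamma\<inverse> = gs_gamma \<circ> gs_gamma"
  by (rule ta_inverse_unique; simp add: fun_eq_iff comp_apply id_apply gs_x_cube gs_gamma_cube)+

lemma gs_x_sq: "gs_x \<circ> (gs_x \<circ> f) = gs_x\<inverse> \<circ> f" "gs_x\<inverse> \<circ> gs_x\<inverse> = gs_x"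
  by (simp_all add: gs_x_inv comp_assoc) (simp add: fun_eq_iff comp_apply gs_x_cube)

text \<open>Both generators have order three, so their inverses are products of generators and do not need
cases of their own.\<close>

lemma GS_induct [consumes 1, case_names one x gamma]:
  assumes f: "f \<in> GS"
    and P: "P id" "\<And>g. g \<in> GS \<Longrightarrow> P g \<Longrightarrow> P (gs_x \<circ> g)"
      "\<And>g. g \<in> GS \<Longrightarrow> P g \<Longrightarrow> P (gs_gamma \<circ> g)"
  shows "P f"
proof -
  have "f \<in> GS \<and> (\<forall>g\<in>GS. P g \<longrightarrow> P (f \<circ> g))"
    using f unfolding carrier_gupta_sidki
  proof (induction f rule: generate.induct)
    case one
    have "\<one>\<^bsub>tree_Aut\<^esub> = id" by (simp add: tree_Aut_def)
    then show ?case by (simp flip: carrier_gupta_sidki)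
  next
    case (incl h)
    then show ?case using P(2,3) by (auto simp flip: carrier_gupta_sidki)
  next
    case (inv h)
    then show ?case using P(2,3)
      by (auto simp: ta_inv_tree_Aut gs_x_inv gs_gamma_inv comp_assoc simp flip: carrier_gupta_sidki)
  next
    case (eng h k)
    have "h \<otimes>\<^bsub>tree_Aut\<^esub> k = h \<circ> k" by (simp add: tree_Aut_def)
    with eng show ?case by (simp add: comp_assoc flip: carrier_gupta_sidki)
  qed
  then show ?thesis using P(1) by force
qed

lemma GS_subgroup_iff:
  "subgroup N gupta_sidki \<longleftrightarrow>
    N \<subseteq> GS \<and> id \<in> N \<and> (\<forall>f\<in>N. \<forall>g\<in>N. f \<circ> g \<in> N) \<and> (\<forall>f\<in>N. f\<inverse> \<in> N)"
  (is "?L \<longleftrightarrow> ?R")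
proof
  assume ?L
  then have "N \<subseteq> GS" by (rule subgroup.subset)
  with \<open>?L\<close> show ?R
    using subgroup.one_closed[of N gupta_sidki] subgroup.m_closed[of N gupta_sidki]
      subgroup.m_inv_closed[of N gupta_sidki] by (simp add: subset_iff)
next
  assume ?R
  then show ?L by (unfold_locales) (auto simp: subset_iff)
qed

lemma rt_gens [simp]: "rt gs_x c = c + 1" "rt gs_gamma c = c"
  by (cases c; simp add: rt_def letter_defs)+

lemma sec_gens [simp]:
  "sec gs_x c = id"
  "sec gs_gamma 0 = gs_gamma" "sec gs_gamma 1 = gs_x" "sec gs_gamma (-1) = gs_x\<inverse>"
  by (cases c) (simp_all add: sec_def fun_eq_iff id_apply letter_defs ta_inv_tree_Aut)

definition xexp :: "(letter list \<Rightarrow> letter list) \<Rightarrow> letter"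
  where "xexp g = rt g 0"

text \<open>The exponent sum of \<open>\<gamma>\<close> modulo 3. Since \<open>\<gamma> = (\<gamma>, x, x\<inverse>)\<close>, it can be read off from the action on the
second level: for \<open>\<gamma>\<close> the difference of the \<open>x\<close>-exponents of the last two sections is
\<open>-1 - 1 = 1\<close>, and for \<open>x\<close> it is \<open>0\<close>.\<close>

definition gexp :: "(letter list \<Rightarrow> letter list) \<Rightarrow> letter"
  where "gexp g = xexp (sec g (-1)) - xexp (sec g 1)"

lemma GS_rt: "g \<in> GS \<Longrightarrow> rt g c = c + xexp g"
proof (induction arbitrary: c rule: GS_induct)
  case one show "rt id c = c + xexp id" by (simp add: xexp_def)
next
  case (x g)
  have "xexp (gs_x \<circ> g) = xexp g + 1" using x(1) by (simp add: xexp_def)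
  with x show "rt (gs_x \<circ> g) c = c + xexp (gs_x \<circ> g)" by (simp add: add.assoc)
next
  case (gamma g)
  have "xexp (gs_gamma \<circ> g) = xexp g" using gamma(1) by (simp add: xexp_def)
  with gamma show "rt (gs_gamma \<circ> g) c = c + xexp (gs_gamma \<circ> g)" by simp
qed

lemma GS_sec [simp]: "g \<in> GS \<Longrightarrow> sec g c \<in> GS"
proof (induction arbitrary: c rule: GS_induct)
  case one show "sec id c \<in> GS" by simp
next
  case (x g) then show "sec (gs_x \<circ> g) c \<in> GS" by simp
next
  case (gamma g)
  have "sec gs_gamma d \<in> GS" for d using letter_cases[of d] by auto
  with gamma show "sec (gs_gamma \<circ> g) c \<in> GS" by simp
qed

lemma xexp_comp [simp]: "f \<in> GS \<Longrightarrow> g \<in> GS \<Longrightarrow> xexp (f \<circ> g) = xexp f + xexp g"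
  using GS_rt[of f "xexp g"] by (simp add: xexp_def[of "f \<circ> g"] xexp_def[of g] add.commute)

lemma exp_id [simp]: "xexp id = 0" "gexp id = 0"
  by (simp_all add: xexp_def gexp_def)

lemma xexp_inv [simp]: "f \<in> GS \<Longrightarrow> xexp (f\<inverse>) = - xexp f"
  using xexp_comp[of f "f\<inverse>"] by (simp del: xexp_comp add: eq_neg_iff_add_eq_0 add.commute)

lemma xexp_gens [simp]: "xexp gs_x = 1" "xexp gs_gamma = 0"
  by (simp_all add: xexp_def)

lemma xexp_sec_sum:
  "g \<in> GS \<Longrightarrow> xexp (sec g (-1)) + xexp (sec g 0) + xexp (sec g 1) = 0"
proof (induction rule: GS_induct)
  case one show "xexp (sec id (-1)) + xexp (sec id 0) + xexp (sec id 1) = 0" by simp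
next
  case (x g)
  then show "xexp (sec (gs_x \<circ> g) (-1)) + xexp (sec (gs_x \<circ> g) 0) + xexp (sec (gs_x \<circ> g) 1) = 0"
    by simp
next
  case (gamma g)
  have "sec gs_gamma d \<in> GS" for d using letter_cases[of d] by auto
  with gamma letter_cases[of "xexp g"]
  show "xexp (sec (gs_gamma \<circ> g) (-1)) + xexp (sec (gs_gamma \<circ> g) 0)
      + xexp (sec (gs_gamma \<circ> g) 1) = 0"
    by (auto simp: GS_rt letter_double letter_double' add.assoc)
qed

text \<open>In a product \<open>f \<circ> g\<close> the sections of \<open>f\<close> occur shifted cyclically by \<open>g\<close>, and \<open>gexp\<close> is additive because
it is not affected by such a shift.
The three \<open>x\<close>-exponents sum to zero; hence their consecutive differences coincide in
characteristic three.\<close>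

lemma gexp_shift:
  assumes "g \<in> GS"
  shows "xexp (sec g (c - 1)) - xexp (sec g (c + 1)) = gexp g"
  using letter_cases[of c] xexp_sec_sum[OF assms]
  apply (cases "xexp (sec g (-1))"; cases "xexp (sec g 1)"; cases "xexp (sec g 0)")
  by (auto simp: gexp_def letter_defs)

lemma gexp_comp [simp]:
  assumes f: "f \<in> GS" and g: "g \<in> GS"
  shows "gexp (f \<circ> g) = gexp f + gexp g"
  using gexp_shift[OF f, of "xexp g"] f g
  by (simp add: gexp_def GS_rt algebra_simps)

lemma gexp_inv [simp]: "f \<in> GS \<Longrightarrow> gexp (f\<inverse>) = - gexp f"
  using gexp_comp[of f "f\<inverse>"] by (simp del: gexp_comp add: eq_neg_iff_add_eq_0 add.commute)

lemma gexp_gens [simp]: "gexp gs_x = 0" "gexp gs_gamma = 1"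
  by (simp_all add: gexp_def letter_double')

text \<open>The sections of an element of \<open>G\<close> are not independent. Modulo \<open>G'\<close> an element of the stabilizer of the
first level is \<open>b\<^sub>0\<^sup>i b\<^sub>1\<^sup>j b\<^sub>2\<^sup>k\<close> with \<open>b\<^sub>0 = (\<gamma>, x, x\<inverse>)\<close>, \<open>b\<^sub>1 = (x\<inverse>, \<gamma>, x)\<close>, \<open>b\<^sub>2 = (x, x\<inverse>, \<gamma>)\<close>, and \<open>i\<close>,
\<open>j\<close>, \<open>k\<close> are the \<open>gexp\<close> of the sections, which determine the \<open>xexp\<close> of the sections. The
relation is inherited under products, so it is enough to check it for generators.\<close>

lemma xexp_sec:
  "g \<in> GS \<Longrightarrow> xexp (sec g c) = gexp (sec g (c - 1)) - gexp (sec g (c + 1))"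
proof (induction arbitrary: c rule: GS_induct)
  case one show "xexp (sec id c) = gexp (sec id (c - 1)) - gexp (sec id (c + 1))" by simp
next
  case (x g)
  then show "xexp (sec (gs_x \<circ> g) c)
      = gexp (sec (gs_x \<circ> g) (c - 1)) - gexp (sec (gs_x \<circ> g) (c + 1))"
    by simp
next
  case (gamma g)
  have G: "sec gs_gamma d \<in> GS" for d using letter_cases[of d] by auto
  have "xexp (sec gs_gamma d) = gexp (sec gs_gamma (d - 1)) - gexp (sec gs_gamma (d + 1))" for d
    using letter_cases[of d] by (auto simp: letter_double letter_double')
  note A = this[of "c + xexp g"]
  have e: "c - 1 + xexp g = c + xexp g - 1" "c + 1 + xexp g = c + xexp g + 1" by simp_all
  show "xexp (sec (gs_gamma \<circ> g) c)
      = gexp (sec (gs_gamma \<circ> g) (c - 1)) - gexp (sec (gs_gamma \<circ> g) (c + 1))"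
    using gamma G by (simp add: GS_rt e A gamma(2)[of c])
qed

lemma gexp_sec_sum:
  assumes "g \<in> GS"
  shows "gexp g = gexp (sec g (-1)) + gexp (sec g 0) + gexp (sec g 1)"
  using xexp_sec[OF assms, of 1] xexp_sec[OF assms, of "-1"]
  unfolding gexp_def[of g]
  by (cases "gexp (sec g (-1))"; cases "gexp (sec g 1)"; cases "gexp (sec g 0)")
     (auto simp: letter_defs)

text \<open>Powers of an element of order three, with the exponent in the field with three elements.\<close>

definition lpow :: "(letter list \<Rightarrow> letter list) \<Rightarrow> letter \<Rightarrow> letter list \<Rightarrow> letter list"
  where "lpow f i = (if i = 0 then id else if i = 1 then f else f\<inverse>)"

lemma lpow_GS [simp]: "f \<in> GS \<Longrightarrow> lpow f i \<in> GS"
  by (simp add: lpow_def)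

lemma exp_lpow [simp]: "f \<in> GS \<Longrightarrow> xexp (lpow f i) = i * xexp f"
  "f \<in> GS \<Longrightarrow> gexp (lpow f i) = i * gexp f"
  using letter_cases[of i] by (auto simp: lpow_def letter_distinct)

lemma lpow_Suc: "lpow gs_x (i + 1) = gs_x \<circ> lpow gs_x i"
    "lpow gs_gamma (i + 1) = gs_gamma \<circ> lpow gs_gamma i"
  using letter_cases[of i]
  by (auto simp: lpow_def letter_distinct letter_double gs_x_inv[symmetric] gs_gamma_inv[symmetric])

lemma GS_with_exps: "\<exists>g\<in>GS. xexp g = i \<and> gexp g = j"
  by (rule bexI[of _ "lpow gs_x i \<circ> lpow gs_gamma j"]) simp_all

lemma conj_x_sec:
  assumes "ta f"
  shows "rt (lpow gs_x i \<circ> f \<circ> (lpow gs_x i)\<inverse>) c = rt f (c - i) + i"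
    and "sec (lpow gs_x i \<circ> f \<circ> (lpow gs_x i)\<inverse>) c = sec f (c - i)"
proof -
  have r: "rt (lpow gs_x i) c = c + i" for c i by (simp add: GS_rt)
  have s: "sec (lpow gs_x i) c = id" for i c
    by (simp add: lpow_def sec_inv)
  have ri: "rt ((lpow gs_x i)\<inverse>) c = c - i" by (simp add: GS_rt)
  show "rt (lpow gs_x i \<circ> f \<circ> (lpow gs_x i)\<inverse>) c = rt f (c - i) + i"
    "sec (lpow gs_x i \<circ> f \<circ> (lpow gs_x i)\<inverse>) c = sec f (c - i)"
    using assms by (simp_all add: r s ri sec_inv)
qed

text \<open>The three conjugates of \<open>\<gamma>\<close> by powers of \<open>x\<close>, whose sections are those of \<open>\<gamma>\<close> cyclically shifted.
They generate the stabilizer of the first level.\<close>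

definition gconj :: "letter \<Rightarrow> letter list \<Rightarrow> letter list"
  where "gconj i = lpow gs_x i \<circ> gs_gamma \<circ> (lpow gs_x i)\<inverse>"

lemma gconj_GS [simp]: "gconj i \<in> GS" and rt_gconj [simp]: "rt (gconj i) c = c"
  and sec_gconj: "sec (gconj i) c = sec gs_gamma (c - i)"
  and exp_gconj [simp]: "xexp (gconj i) = 0" "gexp (gconj i) = 1"
  by (simp_all add: gconj_def conj_x_sec del: rt_comp sec_comp)

section \<open>The derived subgroup and the branching structure\<close>

text \<open>The derived subgroup of \<open>G\<close>, described as the kernel of the abelianization map. \<open>GS'_minimal\<close> below
shows that it is contained in every normal subgroup with abelian quotient.\<close>

definition GS' :: "(letter list \<Rightarrow> letter list) set"
  where "GS' = {g \<in> GS. xexp g = 0 \<and> gexp g = 0}"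

lemma subgroup_GS': "subgroup GS' gupta_sidki"
  by (auto simp: GS_subgroup_iff GS'_def)

text \<open>Modulo \<open>N\<close> the generators commute, so every element is \<open>x\<^sup>i \<gamma>\<^sup>j n\<close> with \<open>n\<close> in \<open>N\<close>. For an element of
\<open>G'\<close> the exponents force \<open>i = j = 0\<close>. For the last step \<open>n\<close> itself must have exponents zero, which
is why the normal form is proved with \<open>n\<close> in \<open>N \<inter> G'\<close>.\<close>

lemma GS'_minimal:
  assumes N: "subgroup N gupta_sidki"
    and conj: "\<And>g n. g \<in> GS \<Longrightarrow> n \<in> N \<Longrightarrow> g \<circ> n \<circ> g\<inverse> \<in> N"
    and comm: "gs_gamma \<circ> gs_x\<inverse> \<circ> gs_gamma\<inverse> \<circ> gs_x \<in> N"
  shows "GS' \<subseteq> N"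
proof
  note N' = N[unfolded GS_subgroup_iff]
  let ?c = "gs_gamma \<circ> gs_x\<inverse> \<circ> gs_gamma\<inverse> \<circ> gs_x"
  have conj': "g\<inverse> \<circ> n \<circ> g \<in> N" if "g \<in> GS" "n \<in> N" for g n
    using conj[of "g\<inverse>" n] that by simp
  have k: "gs_gamma\<inverse> \<circ> (lpow gs_x i)\<inverse> \<circ> gs_gamma \<circ> lpow gs_x i \<in> N" for i
  proof -
    have "gs_gamma\<inverse> \<circ> ?c\<inverse> \<circ> gs_gamma \<in> N" "gs_gamma\<inverse> \<circ> (gs_x \<circ> ?c \<circ> gs_x\<inverse>) \<circ> gs_gamma \<in> N"
      using comm N' by (auto intro!: conj' conj)
    then show ?thesis
      using letter_cases[of i] N'
      by (auto simp: lpow_def letter_distinct comp_assoc ta_inv_comp)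
  qed
  have form: "\<exists>i j. \<exists>n\<in>N \<inter> GS'. g = lpow gs_x i \<circ> lpow gs_gamma j \<circ> n" if "g \<in> GS" for g
    using that
  proof (induction rule: GS_induct)
    case one
    have "id = lpow gs_x 0 \<circ> lpow gs_gamma 0 \<circ> id" by (simp add: lpow_def)
    then show ?case using N' subgroup_GS' unfolding GS_subgroup_iff by blast
  next
    case (x g)
    then obtain i j n where n: "n \<in> N \<inter> GS'" "g = lpow gs_x i \<circ> lpow gs_gamma j \<circ> n" by blast
    then have "gs_x \<circ> g = lpow gs_x (i + 1) \<circ> lpow gs_gamma j \<circ> n"
      by (simp add: lpow_Suc comp_assoc)
    with n show ?case by blast
  next
    case (gamma g)
    then obtain i j n where n: "n \<in> N \<inter> GS'" "g = lpow gs_x i \<circ> lpow gs_gamma j \<circ> n" by blast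
    define k where "k = gs_gamma\<inverse> \<circ> (lpow gs_x i)\<inverse> \<circ> gs_gamma \<circ> lpow gs_x i"
    define m where "m = (lpow gs_gamma j)\<inverse> \<circ> k \<circ> lpow gs_gamma j \<circ> n"
    have "gs_gamma \<circ> g = lpow gs_x i \<circ> lpow gs_gamma (j + 1) \<circ> m"
      by (simp add: n m_def k_def lpow_Suc comp_assoc)
    moreover have "m \<in> N"
      using n k[of i] N' unfolding m_def k_def by (auto intro!: conj')
    moreover have "m \<in> GS'"
      using n by (simp add: m_def k_def GS'_def)
    ultimately show ?case by blast
  qed
  fix g assume g: "g \<in> GS'"
  then obtain i j n where n: "n \<in> N" "n \<in> GS'" "g = lpow gs_x i \<circ> lpow gs_gamma j \<circ> n"
    using form[of g] by (auto simp: GS'_def)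
  with g have "i = 0" "j = 0" by (simp_all add: GS'_def)
  with n show "g \<in> N" by (simp add: lpow_def)
qed

primrec implant :: "letter list \<Rightarrow> (letter list \<Rightarrow> letter list) \<Rightarrow> letter list \<Rightarrow> letter list" where
  "implant [] g = g"
| "implant (c # v) g = branch (\<lambda>d. if d = c then implant v g else id)"

lemma ta_implant [simp]: "ta g \<Longrightarrow> ta (implant v g)"
  by (induction v) simp_all

lemma implant_comp: "implant v f \<circ> implant v g = implant v (f \<circ> g)"
proof (induction v)
  case (Cons c v)
  then show ?case by (simp add: branch_comp if_distrib cong: if_cong)
qed simp

lemma implant_inv: "ta g \<Longrightarrow> (implant v g)\<inverse> = implant v (g\<inverse>)"
proof (induction v)
  case (Cons c v)
  then show ?case by (simp add: branch_inv if_distrib cong: if_cong)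
qed simp

lemma implant_id [simp]: "implant v id = id"
  by (induction v) (simp_all cong: if_cong)

lemma sec_stab_surj: "h \<in> GS \<Longrightarrow> \<exists>y\<in>GS. xexp y = 0 \<and> sec y c = h"
proof (induction rule: GS_induct)
  case one
  show ?case by (rule bexI[of _ id]) simp_all
next
  case (x g)
  then obtain y where "y \<in> GS" "xexp y = 0" "sec y c = g" by blast
  then show ?case
    by (intro bexI[of _ "gconj (c - 1) \<circ> y"]) (simp_all add: sec_gconj GS_rt)
next
  case (gamma g)
  then obtain y where "y \<in> GS" "xexp y = 0" "sec y c = g" by blast
  then show ?case
    by (intro bexI[of _ "gconj c \<circ> y"]) (simp_all add: sec_gconj GS_rt)
qed

lemma branch_conj_implant:
  assumes "y \<in> GS" "xexp y = 0" "ta g"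
  shows "y \<circ> implant [c] g \<circ> y\<inverse> = implant [c] (sec y c \<circ> g \<circ> (sec y c)\<inverse>)"
proof (rule ta_eqI)
  have r: "rt y d = d" "rt (y\<inverse>) d = d" for d using assms by (simp_all add: GS_rt)
  fix d
  show "rt (y \<circ> implant [c] g \<circ> y\<inverse>) d = rt (implant [c] (sec y c \<circ> g \<circ> (sec y c)\<inverse>)) d"
    "sec (y \<circ> implant [c] g \<circ> y\<inverse>) d = sec (implant [c] (sec y c \<circ> g \<circ> (sec y c)\<inverse>)) d"
    using assms r by (simp_all add: sec_inv)
qed (use assms in simp_all)

text \<open>The branching property. By \<open>GS'_minimal\<close> it suffices to implant a single commutator:
\<open>b\<^sub>0 b\<^sub>1 = (\<gamma> x\<inverse>, x \<gamma>, 1)\<close> and \<open>b\<^sub>0 b\<^sub>2 = (\<gamma> x, 1, x\<inverse> \<gamma>)\<close> do not share a nontrivial section except the first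
one, so that their commutator is concentrated there. It is the commutator of \<open>\<gamma> x\<inverse>\<close> and \<open>\<gamma> x\<close>, a
conjugate of the one of \<open>\<gamma>\<close> and \<open>x\<inverse>\<close>.\<close>

lemma implant_GS'_0:
  assumes "g \<in> GS'"
  shows "implant [0] g \<in> GS"
proof -
  define N where "N = {g \<in> GS. implant [0] g \<in> GS}"
  have "GS' \<subseteq> N"
  proof (rule GS'_minimal)
    show "subgroup N gupta_sidki"
      by (auto simp: GS_subgroup_iff N_def simp del: implant.simps
          simp flip: implant_comp implant_inv)
    show conj: "h \<circ> n \<circ> h\<inverse> \<in> N" if h: "h \<in> GS" and n: "n \<in> N" for h n
    proof -
      obtain y where y: "y \<in> GS" "xexp y = 0" "sec y 0 = h" using sec_stab_surj[OF h] by blast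
      have "y \<circ> implant [0] n \<circ> y\<inverse> \<in> GS" using y n by (simp add: N_def del: implant.simps)
      then show ?thesis using branch_conj_implant[of y n 0] y n h
        by (simp add: N_def del: implant.simps)
    qed
    let ?p = "gs_gamma \<circ> gs_x\<inverse>" and ?q = "gs_gamma \<circ> gs_x"
    let ?P = "gconj 0 \<circ> gconj 1" and ?Q = "gconj 0 \<circ> gconj (-1)"
    have e: "?P \<circ> ?Q \<circ> ?P\<inverse> \<circ> ?Q\<inverse> = implant [0] (?p \<circ> ?q \<circ> ?p\<inverse> \<circ> ?q\<inverse>)"
    proof (rule ta_eqI)
      have r: "rt ((gconj i)\<inverse>) c = c" for i c by (simp add: GS_rt)
      fix c
      show "rt (?P \<circ> ?Q \<circ> ?P\<inverse> \<circ> ?Q\<inverse>) c = rt (implant [0] (?p \<circ> ?q \<circ> ?p\<inverse> \<circ> ?q\<inverse>)) c"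
        by (simp add: ta_inv_comp r)
      show "sec (?P \<circ> ?Q \<circ> ?P\<inverse> \<circ> ?Q\<inverse>) c = sec (implant [0] (?p \<circ> ?q \<circ> ?p\<inverse> \<circ> ?q\<inverse>)) c"
        using letter_cases[of c]
        by (auto simp: ta_inv_comp r sec_inv sec_gconj comp_assoc letter_double letter_double' letter_distinct)
    qed simp_all
    have "?P \<circ> ?Q \<circ> ?P\<inverse> \<circ> ?Q\<inverse> \<in> GS" by simp
    then have "?p \<circ> ?q \<circ> ?p\<inverse> \<circ> ?q\<inverse> \<in> N" by (simp add: e N_def del: implant.simps)
    from conj[OF _ this, of "?p\<inverse>"]
    show "gs_gamma \<circ> gs_x\<inverse> \<circ> gs_gamma\<inverse> \<circ> gs_x \<in> N"
      by (simp add: ta_inv_comp comp_assoc gs_x_sq)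
  qed
  with assms show ?thesis by (auto simp: N_def)
qed

lemma implant_conj_x:
  assumes "ta g"
  shows "lpow gs_x c \<circ> implant [0] g \<circ> (lpow gs_x c)\<inverse> = implant [c] g"
  by (rule ta_eqI) (simp_all add: conj_x_sec assms del: rt_comp sec_comp)

lemma implant_GS':
  assumes "g \<in> GS'"
  shows "implant v g \<in> GS'"
  using assms
proof (induction v)
  case (Cons c v)
  then have g: "implant v g \<in> GS'" by blast
  then have "ta (implant v g)" "gexp (implant v g) = 0" by (simp_all add: GS'_def)
  have G: "implant [c] (implant v g) \<in> GS"
    using implant_GS'_0[OF g] implant_conj_x[OF \<open>ta (implant v g)\<close>, of c]
    by (metis GS_closed lpow_GS GS_gens(1))
  moreover have "xexp (implant [c] (implant v g)) = 0" by (simp add: xexp_def)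
  moreover have "gexp (implant [c] (implant v g)) = 0"
    using gexp_sec_sum[OF G] \<open>gexp (implant v g) = 0\<close> by simp
  ultimately show ?case by (simp add: GS'_def cong: if_cong)
qed simp

lemma GS'_GS [simp]: "g \<in> GS' \<Longrightarrow> g \<in> GS"
  by (simp add: GS'_def)

lemma lpow_sec: "ta f \<Longrightarrow> rt f c = c \<Longrightarrow> sec (lpow f i) c = lpow (sec f c) i"
  using sec_inv_rt[of f c] by (simp add: lpow_def)

lemma gexp_sec_gconj: "gexp (sec (gconj i) c) = (if c = i then 1 else 0)"
  using letter_cases[of "c - i"] by (auto simp: sec_gconj letter_distinct)

text \<open>The \<open>gexp\<close> of the three sections can be prescribed independently, since each of the three conjugates
of \<open>\<gamma>\<close> contributes to exactly one of them.\<close>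

lemma stab_with_gexps: "\<exists>h\<in>GS. xexp h = 0 \<and> (\<forall>c. gexp (sec h c) = v c)"
proof -
  define h where "h = lpow (gconj 0) (v 0) \<circ> lpow (gconj 1) (v 1) \<circ> lpow (gconj (-1)) (v (-1))"
  have r: "rt (lpow (gconj i) j) c = c" for i j c by (simp add: GS_rt)
  have "gexp (sec h c) = v c" for c
    using letter_cases[of c]
    by (auto simp: h_def r lpow_sec gexp_sec_gconj letter_distinct)
  moreover have "h \<in> GS" "xexp h = 0" by (simp_all add: h_def)
  ultimately show ?thesis by blast
qed

lemma branch_split:
  "branch F = implant [0] (F 0) \<circ> implant [1] (F 1) \<circ> implant [-1] (F (-1))"
  unfolding implant.simps branch_comp
  by (rule arg_cong[where f = branch]) (use letter_cases in \<open>force simp: letter_distinct\<close>)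

text \<open>The converse of \<open>xexp_sec\<close>. Divide the triple by the sections of an element of \<open>G\<close> that has the same
\<open>gexp\<close> at each vertex. By \<open>xexp_sec\<close> and the assumption the \<open>xexp\<close> agree as well, so the quotient
is a triple of elements of \<open>G'\<close>, which lies in \<open>G\<close> by the branching property.\<close>

proposition branch_GS:
  assumes F: "\<And>c. F c \<in> GS"
    and rel: "\<And>c. xexp (F c) = gexp (F (c - 1)) - gexp (F (c + 1))"
  shows "branch F \<in> GS"
proof -
  obtain h where h: "h \<in> GS" "xexp h = 0" "\<And>c. gexp (sec h c) = gexp (F c)"
    using stab_with_gexps[of "\<lambda>c. gexp (F c)"] by blast
  have "F c \<circ> (sec h c)\<inverse> \<in> GS'" for c
    using F h rel[of c] xexp_sec[OF h(1), of c] by (simp add: GS'_def del: GS'_GS)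
  then have "branch (\<lambda>c. F c \<circ> (sec h c)\<inverse>) \<in> GS"
    unfolding branch_split[of "\<lambda>c. F c \<circ> (sec h c)\<inverse>"]
    by (intro GS_closed GS'_GS implant_GS')
  then have "branch (\<lambda>c. F c \<circ> (sec h c)\<inverse>) \<circ> h \<in> GS" using h by simp
  moreover have "branch (\<lambda>c. F c \<circ> (sec h c)\<inverse>) \<circ> h = branch F"
  proof (rule ta_eqI)
    have ta: "ta (F c)" "ta (sec h c)" "ta h" for c using F h by simp_all
    have r: "rt h c = c" for c using h by (simp add: GS_rt)
    show "ta (branch (\<lambda>c. F c \<circ> (sec h c)\<inverse>) \<circ> h)" "ta (branch F)" using ta by simp_all
    fix c
    show "rt (branch (\<lambda>c. F c \<circ> (sec h c)\<inverse>) \<circ> h) c = rt (branch F) c"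
      "sec (branch (\<lambda>c. F c \<circ> (sec h c)\<inverse>) \<circ> h) c = sec (branch F) c"
      using ta by (simp_all add: r comp_assoc)
  qed
  ultimately show ?thesis by simp
qed

lemma stab_with_section:
  assumes h: "h \<in> GS" "gexp h = v c" "xexp h = v (c - 1) - v (c + 1)"
  shows "\<exists>y\<in>GS. xexp y = 0 \<and> sec y c = h \<and> (\<forall>d. gexp (sec y d) = v d)"
proof -
  have "\<exists>g\<in>GS. xexp g = v (d - 1) - v (d + 1) \<and> gexp g = v d" for d
    by (rule GS_with_exps)
  then obtain f where f: "\<And>d. f d \<in> GS" "\<And>d. xexp (f d) = v (d - 1) - v (d + 1)"
    "\<And>d. gexp (f d) = v d" by metis
  define F where "F = f(c := h)"
  have F: "F d \<in> GS" "xexp (F d) = v (d - 1) - v (d + 1)" "gexp (F d) = v d" for d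
    using f h by (simp_all add: F_def)
  have "branch F \<in> GS" using F by (intro branch_GS) simp_all
  moreover have "xexp (branch F) = 0" by (simp add: xexp_def)
  moreover have "F c = h" by (simp add: F_def)
  ultimately show ?thesis using F by (intro bexI[of _ "branch F"]) simp_all
qed

text \<open>Although \<open>G'\<close> is smaller than the stabilizer of the first level, each single section of its
elements is arbitrary: the \<open>gexp\<close> at the other two vertices can be solved for such that the
relation at \<open>c\<close> holds and the total is zero.\<close>

lemma derived_section:
  assumes h: "h \<in> GS"
  shows "\<exists>y\<in>GS'. sec y c = h"
proof -
  define v where "v d = (if d = c then gexp h else if d = c + 1 then gexp h + xexp h
    else gexp h - xexp h)" for d
  have "v (c - 1) - v (c + 1) = xexp h"
    by (cases c; cases "xexp h"; cases "gexp h") (simp_all add: v_def letter_defs)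
  then obtain y where y: "y \<in> GS" "xexp y = 0" "sec y c = h" "\<And>d. gexp (sec y d) = v d"
    using stab_with_section[OF h, of v c] by (auto simp: v_def)
  have "v (-1) + v 0 + v 1 = 0"
    by (cases c; cases "xexp h"; cases "gexp h") (simp_all add: v_def letter_defs)
  then have "gexp y = 0" using gexp_sec_sum[OF y(1)] by (simp add: y(4))
  with y have "y \<in> GS'" by (simp add: GS'_def del: GS'_GS)
  with y show ?thesis by blast
qed

section \<open>Centralizers of normal subgroups are trivial\<close>

lemma GS_transitive: "length v = length w \<Longrightarrow> \<exists>g\<in>GS. g v = w"
proof (induction v w rule: list_induct2)
  case Nil
  then show ?case by (intro bexI[of _ id]) simp_all
next
  case (Cons c v d w)
  then obtain g where g: "g \<in> GS" "g v = w" by blast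
  then obtain y where y: "y \<in> GS'" "sec y d = g" using derived_section by blast
  have "xexp y = 0" using y by (simp add: GS'_def del: GS'_GS)
  have s: "sec (lpow gs_x i) c = id" for i c by (simp add: lpow_def sec_inv)
  have "(y \<circ> lpow gs_x (d - c)) (c # v) = d # w"
    using y g \<open>xexp y = 0\<close> by (simp add: comp_apply ta_Cons GS_rt s id_apply)
  with y show ?case by (intro bexI[of _ "y \<circ> lpow gs_x (d - c)"]) simp_all
qed

text \<open>A power of \<open>m\<close> brings the first letter into place, and then an element of \<open>G'\<close>, whose section there can
be any element of \<open>G\<close>, corrects the remaining letters.\<close>

lemma subgroup_transitive:
  assumes M: "subgroup M gupta_sidki" "GS' \<subseteq> M" and m: "m \<in> M" "xexp m \<noteq> 0"
    and len: "length v = length w"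
  shows "\<exists>g\<in>M. g v = w"
proof (cases v)
  case Nil
  then show ?thesis using len M(1) by (auto simp: GS_subgroup_iff id_apply intro!: bexI[of _ id])
next
  case (Cons c v')
  then obtain d w' where w: "w = d # w'" using len by (cases w) auto
  note M' = M(1)[unfolded GS_subgroup_iff]
  define p where "p = lpow m ((d - c) * xexp m)"
  have p: "p \<in> M" "p \<in> GS" using M' m(1) by (auto simp: p_def lpow_def)
  have "xexp m * xexp m = 1" using m(2) letter_cases[of "xexp m"] by auto
  then have "xexp p = d - c" using m M' by (simp add: p_def mult.assoc subset_iff)
  then have pv: "p v = d # sec p c v'" using p Cons by (simp add: ta_Cons GS_rt)
  have "length (sec p c v') = length w'" using p len Cons w by simp
  then obtain g where g: "g \<in> GS" "g (sec p c v') = w'" using GS_transitive by blast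
  then obtain y where y: "y \<in> GS'" "sec y d = g" using derived_section by blast
  have "xexp y = 0" using y by (simp add: GS'_def del: GS'_GS)
  then have "(y \<circ> p) v = w" using y g pv w by (simp add: comp_apply ta_Cons GS_rt)
  then show ?thesis using y p M M' by blast
qed

lemma implant_append [simp]: "implant v g (v @ u) = v @ g u"
  by (induction v) auto

lemma implant_off: "(\<And>u. w \<noteq> v @ u) \<Longrightarrow> implant v g w = w"
proof (induction v arbitrary: w)
  case (Cons c v)
  show ?case
  proof (cases w)
    case w: (Cons d w')
    then have "d = c \<Longrightarrow> implant v g w' = w'" using Cons by (intro Cons.IH) auto
    then show ?thesis using w by (simp add: id_apply)
  qed simp
next
  case Nil then show ?case by (metis append_Nil)
qed

lemma ta_prefix:
  assumes f: "ta f"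
  shows "\<exists>u'. f (v @ u) = f v @ u'"
proof (induction u rule: rev_induct)
  case (snoc c u)
  obtain d where "f ((v @ u) @ [c]) = f (v @ u) @ [d]"
    using ta_length_snoc[OF f] by blast
  then show ?case using snoc by auto
qed simp

lemma ta_moves_subtree:
  assumes f: "ta f" and v: "f v \<noteq> v"
  shows "f (v @ u) \<noteq> v @ u'"
proof -
  obtain t where "f (v @ u) = f v @ t" using ta_prefix[OF f] by blast
  moreover have "length (f v) = length v" using f by simp
  ultimately show ?thesis using v by auto
qed

text \<open>If \<open>x\<close> moves \<open>v\<close>, then \<open>x p x\<inverse>\<close> is supported away from the subtree below \<open>v\<close> when \<open>p\<close> is supported
on it. So in a commutator with an element supported below \<open>v\<close> the factor \<open>x p x\<inverse>\<close> cancels, and what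
remains of \<open>[[x, p], q]\<close> is a commutator of \<open>p\<inverse>\<close> and \<open>q\<close> alone.\<close>

lemma double_commutator:
  assumes x: "ta x" "x v \<noteq> v" and p: "ta p" and q: "ta q"
  defines "k \<equiv> x \<circ> implant v p \<circ> x\<inverse> \<circ> (implant v p)\<inverse>"
  shows "k \<circ> implant v q \<circ> k\<inverse> \<circ> (implant v q)\<inverse> = implant v (p\<inverse> \<circ> q \<circ> p \<circ> q\<inverse>)"
proof
  fix w
  define z where "z = x \<circ> implant v p \<circ> x\<inverse>"
  have z: "ta z" using x p by (simp add: z_def)
  have zfix: "z (v @ u) = v @ u" for u
  proof -
    have "implant v p (x\<inverse> (v @ u)) = x\<inverse> (v @ u)"
    proof (rule implant_off)
      fix t show "x\<inverse> (v @ u) \<noteq> v @ t"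
        using ta_moves_subtree[OF x, of t u] x(1) ta_inv_apply(2) by metis
    qed
    then show ?thesis using x by (simp add: z_def comp_apply)
  qed
  then have zfix': "z\<inverse> (v @ u) = v @ u" for u using z by (metis ta_inv_apply(1))
  have k: "k = z \<circ> implant v (p\<inverse>)" "k\<inverse> = implant v p \<circ> z\<inverse>"
    using x p by (simp_all add: k_def z_def ta_inv_comp implant_inv comp_assoc)
  show "(k \<circ> implant v q \<circ> k\<inverse> \<circ> (implant v q)\<inverse>) w = implant v (p\<inverse> \<circ> q \<circ> p \<circ> q\<inverse>) w"
  proof (cases "\<exists>u. w = v @ u")
    case True
    then show ?thesis using p q z
      by (auto simp: k(1) ta_inv_comp implant_inv comp_apply zfix zfix')
  next
    case False
    then have w: "implant v g w = w" for g by (intro implant_off) auto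
    have "z\<inverse> w \<noteq> v @ u" for u using False z zfix by (metis ta_inv_apply(2))
    then have w': "implant v g (z\<inverse> w) = z\<inverse> w" for g by (intro implant_off) auto
    show ?thesis using p q z
      by (simp add: k(1) ta_inv_comp implant_inv comp_apply w w')
  qed
qed

lemma GS'_not_abelian: "\<exists>p\<in>GS'. \<exists>q\<in>GS'. p\<inverse> \<circ> q \<circ> p \<circ> q\<inverse> \<noteq> id"
proof -
  obtain p q where pq: "p \<in> GS'" "q \<in> GS'" "sec p 0 = gs_x" "sec q 0 = gs_gamma"
    using derived_section[of gs_x 0] derived_section[of gs_gamma 0] by auto
  have ta: "ta p" "ta q" using pq by simp_all
  have "p\<inverse> \<circ> q \<circ> p \<circ> q\<inverse> \<noteq> id"
  proof
    assume e: "p\<inverse> \<circ> q \<circ> p \<circ> q\<inverse> = id"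
    have "q \<circ> p = p \<circ> (p\<inverse> \<circ> q \<circ> p \<circ> q\<inverse>) \<circ> q" using ta by (simp add: comp_assoc)
    then have "q \<circ> p = p \<circ> q" by (simp add: e)
    then have "sec (q \<circ> p) 0 = sec (p \<circ> q) 0" by (rule arg_cong)
    moreover have "rt p 0 = 0" "rt q 0 = 0" using pq by (simp_all add: GS'_def GS_rt del: GS'_GS)
    ultimately have "gs_gamma \<circ> gs_x = gs_x \<circ> gs_gamma" using pq ta by simp
    then have "sec (gs_gamma \<circ> gs_x) 0 = sec (gs_x \<circ> gs_gamma) 0" by (rule arg_cong)
    then have "gs_x = gs_gamma" by simp
    then have "xexp gs_x = xexp gs_gamma" by (rule arg_cong)
    then show False by simp
  qed
  with pq show ?thesis by blast
qed

text \<open>Suppose that \<open>x\<close> in \<open>X\<close> and \<open>y\<close> both act nontrivially. They then move vertices of the same level, and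
after conjugating \<open>x\<close> by an element of \<open>M\<close> they move the same vertex \<open>w\<close>. By \<open>double_commutator\<close>, \<open>X\<close>
contains nontrivial elements supported on the subtree below \<open>w\<close>; these do not commute with \<open>y\<close>, which
carries this subtree elsewhere.\<close>

proposition centralizer_trivial:
  assumes M: "subgroup M gupta_sidki" "GS' \<subseteq> M" and m: "m \<in> M" "xexp m \<noteq> 0"
    and X: "subgroup X gupta_sidki" and norm: "\<And>g n. g \<in> M \<Longrightarrow> n \<in> X \<Longrightarrow> g \<circ> n \<circ> g\<inverse> \<in> X"
    and x: "x \<in> X" "x \<noteq> id"
    and y: "y \<in> GS" and comm: "\<And>n. n \<in> X \<Longrightarrow> y \<circ> n = n \<circ> y"
  shows "y = id"
proof (rule ccontr)
  assume "y \<noteq> id"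
  note X' = X[unfolded GS_subgroup_iff] and M' = M(1)[unfolded GS_subgroup_iff]
  have tx: "ta x" and ty: "ta y" using x X' y by auto
  obtain v0 w0 where "x v0 \<noteq> v0" "y w0 \<noteq> w0"
    using x(2) \<open>y \<noteq> id\<close> by (auto simp: fun_eq_iff id_apply)
  then have v: "x (v0 @ w0) \<noteq> v0 @ w0" and yw: "y (w0 @ v0) \<noteq> w0 @ v0"
    using ta_append_move tx ty by blast+
  define w where "w = w0 @ v0"
  obtain g where g: "g \<in> M" "g (v0 @ w0) = w"
    using subgroup_transitive[OF M m, of "v0 @ w0" w] by (auto simp: w_def)
  have tg: "ta g" using g M' by auto
  define x' where "x' = g \<circ> x \<circ> g\<inverse>"
  have x': "x' \<in> X" "ta x'" using norm[OF g(1) x(1)] tx tg by (simp_all add: x'_def)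
  have "x' w = g (x (v0 @ w0))" using g tg by (simp add: x'_def comp_apply flip: g(2))
  then have x'w: "x' w \<noteq> w" using v tg g(2) ta_inj[OF tg] by metis
  obtain p q where pq: "p \<in> GS'" "q \<in> GS'" "p\<inverse> \<circ> q \<circ> p \<circ> q\<inverse> \<noteq> id"
    using GS'_not_abelian by blast
  define n where "n = implant w (p\<inverse> \<circ> q \<circ> p \<circ> q\<inverse>)"
  have "n \<in> X"
  proof -
    let ?r = "implant w p" and ?s = "implant w q"
    define k where "k = x' \<circ> ?r \<circ> x'\<inverse> \<circ> ?r\<inverse>"
    have rs: "?r \<in> M" "?s \<in> M" using pq M(2) implant_GS' by blast+
    have "x' \<circ> (?r \<circ> x'\<inverse> \<circ> ?r\<inverse>) \<in> X" using x' X' norm[OF rs(1)] by blast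
    then have k: "k \<in> X" by (simp add: k_def comp_assoc)
    have "k \<circ> (?s \<circ> k\<inverse> \<circ> ?s\<inverse>) \<in> X" using k X' norm[OF rs(2)] by blast
    moreover have "k \<circ> (?s \<circ> k\<inverse> \<circ> ?s\<inverse>) = n"
      using double_commutator[OF x'(2) x'w, of p q] pq unfolding k_def n_def
      by (simp add: comp_assoc)
    ultimately show ?thesis by simp
  qed
  obtain u where u: "(p\<inverse> \<circ> q \<circ> p \<circ> q\<inverse>) u \<noteq> u" using pq(3) by (auto simp: fun_eq_iff id_apply)
  have "y (w @ u) \<noteq> w @ t" for t
    using ta_moves_subtree[OF ty yw, of u t] unfolding w_def .
  then have "n (y (w @ u)) = y (w @ u)"
    unfolding n_def by (rule implant_off)
  then have "y (n (w @ u)) = y (w @ u)"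
    using comm[OF \<open>n \<in> X\<close>] by (metis comp_apply)
  then have "n (w @ u) = w @ u" using ta_inj[OF ty] by blast
  then show False using u by (simp add: n_def)
qed

section \<open>Automorphisms come from the tree\<close>

abbreviation aut :: "((letter list \<Rightarrow> letter list) \<Rightarrow> (letter list \<Rightarrow> letter list)) \<Rightarrow> bool"
  where "aut \<phi> \<equiv> \<phi> \<in> iso gupta_sidki gupta_sidki"

lemma aut_iff: "aut \<phi> \<longleftrightarrow> bij_betw \<phi> GS GS \<and> (\<forall>f\<in>GS. \<forall>g\<in>GS. \<phi> (f \<circ> g) = \<phi> f \<circ> \<phi> g)"
  by (auto simp: iso_def hom_def bij_betw_def)

lemma aut_GS [simp]: "aut \<phi> \<Longrightarrow> g \<in> GS \<Longrightarrow> \<phi> g \<in> GS"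
  unfolding aut_iff bij_betw_def by blast

lemma aut_comp [simp]: "aut \<phi> \<Longrightarrow> f \<in> GS \<Longrightarrow> g \<in> GS \<Longrightarrow> \<phi> (f \<circ> g) = \<phi> f \<circ> \<phi> g"
  by (simp add: aut_iff)

lemma aut_inj: "aut \<phi> \<Longrightarrow> f \<in> GS \<Longrightarrow> g \<in> GS \<Longrightarrow> \<phi> f = \<phi> g \<longleftrightarrow> f = g"
  unfolding aut_iff bij_betw_def using inj_on_eq_iff by metis

lemma aut_surj: "aut \<phi> \<Longrightarrow> h \<in> GS \<Longrightarrow> \<exists>g\<in>GS. \<phi> g = h"
  unfolding aut_iff bij_betw_def by (metis imageE)

lemma aut_one [simp]: "aut \<phi> \<Longrightarrow> \<phi> id = id"
proof -
  assume phi: "aut \<phi>"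
  then have t: "ta (\<phi> id)" and "\<phi> id = \<phi> id \<circ> \<phi> id" using aut_comp[of \<phi> id id] by simp_all
  then show "\<phi> id = id" by (metis ta_inv_cancel(1,3))
qed

lemma aut_inverse [simp]: "aut \<phi> \<Longrightarrow> g \<in> GS \<Longrightarrow> \<phi> (g\<inverse>) = (\<phi> g)\<inverse>"
  by (rule ta_inverse_unique[symmetric]) (simp_all flip: aut_comp)

lemma aut_eq_id: "aut \<phi> \<Longrightarrow> g \<in> GS \<Longrightarrow> \<phi> g = id \<longleftrightarrow> g = id"
  using aut_inj[of \<phi> g id] by simp

lemma aut_id: "aut id"
  by (simp add: aut_iff id_apply)

text \<open>The rigid stabilizer of a vertex of the first level.\<close>

definition rist :: "letter \<Rightarrow> (letter list \<Rightarrow> letter list) set"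
  where "rist c = {g \<in> GS. xexp g = 0 \<and> (\<forall>d. d \<noteq> c \<longrightarrow> sec g d = id)}"

lemma ristD: "g \<in> rist c \<Longrightarrow> g \<in> GS" "g \<in> rist c \<Longrightarrow> xexp g = 0"
    "g \<in> rist c \<Longrightarrow> d \<noteq> c \<Longrightarrow> sec g d = id"
  by (auto simp: rist_def)

lemma stab_eqI:
  assumes "f \<in> GS" "g \<in> GS" "xexp f = 0" "xexp g = 0" "\<And>c. sec f c = sec g c"
  shows "f = g"
  by (rule ta_eqI) (simp_all add: assms GS_rt)

lemma rist_eqI: "f \<in> rist c \<Longrightarrow> g \<in> rist c \<Longrightarrow> sec f c = sec g c \<Longrightarrow> f = g"
  by (rule stab_eqI) (auto simp: rist_def, metis)

lemma rist_nontrivial: "\<exists>g\<in>rist c. g \<noteq> id"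
proof -
  obtain p where p: "p \<in> GS'" "p \<noteq> id" using GS'_not_abelian
    by (metis comp_id inv_id)
  then have g: "implant [c] p \<in> GS'" by (intro implant_GS')
  have "implant [c] p \<in> rist c" using g by (simp add: rist_def GS'_def del: GS'_GS)
  moreover have "sec (implant [c] p) c = p" by simp
  then have "implant [c] p \<noteq> id" using p by (metis sec_id)
  ultimately show ?thesis by blast
qed

lemma stab_rist_commute:
  assumes "y \<in> GS" "xexp y = 0" "sec y c = id" "g \<in> rist c"
  shows "y \<circ> g = g \<circ> y"
proof (rule stab_eqI)
  fix d
  show "sec (y \<circ> g) d = sec (g \<circ> y) d"
    using assms by (cases "d = c") (simp_all add: rist_def GS_rt)
qed (use assms in \<open>simp_all add: rist_def\<close>)

lemma rist_commute: "c \<noteq> d \<Longrightarrow> f \<in> rist c \<Longrightarrow> g \<in> rist d \<Longrightarrow> f \<circ> g = g \<circ> f"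
  by (rule stab_rist_commute) (auto simp: rist_def)

lemma rist_conj:
  assumes g: "g \<in> GS" and r: "r \<in> rist c"
  shows "g \<circ> r \<circ> g\<inverse> \<in> rist (rt g c)"
proof -
  have rr: "rt r d = d" for d using r by (simp add: rist_def GS_rt)
  have "sec (g \<circ> r \<circ> g\<inverse>) d = id" if "d \<noteq> rt g c" for d
  proof -
    have "rt (g\<inverse>) d \<noteq> c" using that g by auto
    then have "sec r (rt (g\<inverse>) d) = id" using r by (simp add: ristD)
    then show ?thesis using g r by (simp add: ristD(1) rr sec_inv)
  qed
  then show ?thesis using g r by (simp add: rist_def)
qed

lemma rist_disjoint: "c \<noteq> d \<Longrightarrow> g \<in> rist c \<Longrightarrow> g \<in> rist d \<Longrightarrow> g = id"
proof (rule stab_eqI)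
  fix e assume "c \<noteq> d" "g \<in> rist c" "g \<in> rist d"
  then show "sec g e = sec id e" by (cases "e = c") (simp_all add: rist_def)
qed (simp_all add: rist_def)

lemma subgroup_rist: "subgroup (rist c) gupta_sidki"
  by (auto simp: GS_subgroup_iff rist_def GS_rt sec_inv)

lemma aut_image_subgroup:
  assumes "aut \<phi>" "subgroup N gupta_sidki"
  shows "subgroup (\<phi> ` N) gupta_sidki"
  using assms unfolding GS_subgroup_iff
  by (auto simp: subset_iff simp flip: aut_comp aut_inverse intro!: image_eqI[of id \<phi> id])

text \<open>If the image \<open>M\<close> of the level stabilizer \<open>B\<close> moved the first level, then \<open>centralizer_trivial\<close> would
apply to \<open>M\<close>; note that \<open>M\<close> contains \<open>G'\<close> because \<open>B\<close> contains all commutators. But \<open>M\<close> has the commuting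
nontrivial normal subgroups \<open>\<phi>(rist 0)\<close> and \<open>\<phi>(rist 1)\<close>.\<close>

lemma aut_stab_imp:
  assumes phi: "aut \<phi>" and g: "g \<in> GS" "xexp g = 0"
  shows "xexp (\<phi> g) = 0"
proof (rule ccontr)
  assume m: "xexp (\<phi> g) \<noteq> 0"
  define B where "B = {g \<in> GS. xexp g = 0}"
  have B: "subgroup B gupta_sidki" by (auto simp: GS_subgroup_iff B_def)
  have M: "subgroup (\<phi> ` B) gupta_sidki" using phi B by (rule aut_image_subgroup)
  have conj: "h \<circ> n \<circ> h\<inverse> \<in> \<phi> ` N"
    if hn: "h \<in> \<phi> ` A" "n \<in> \<phi> ` N" and sub: "A \<subseteq> GS" "N \<subseteq> GS"
      and norm: "\<And>a n. a \<in> A \<Longrightarrow> n \<in> N \<Longrightarrow> a \<circ> n \<circ> a\<inverse> \<in> N"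
    for h n A N
  proof -
    obtain a k where a: "a \<in> A" "k \<in> N" "h = \<phi> a" "n = \<phi> k" using hn by blast
    then have "h \<circ> n \<circ> h\<inverse> = \<phi> (a \<circ> k \<circ> a\<inverse>)"
      using phi sub by (simp add: subset_iff)
    with a norm show ?thesis by blast
  qed
  have GS: "\<phi> ` GS = GS" using phi by (simp add: aut_iff bij_betw_def)
  have "GS' \<subseteq> \<phi> ` B"
  proof (rule GS'_minimal[OF M])
    show "h \<circ> n \<circ> h\<inverse> \<in> \<phi> ` B" if "h \<in> GS" "n \<in> \<phi> ` B" for h n
      by (rule conj[of h GS n B]) (use that GS in \<open>auto simp: B_def\<close>)
    obtain a b where ab: "a \<in> GS" "b \<in> GS" "\<phi> a = gs_x" "\<phi> b = gs_gamma"
      using aut_surj[OF phi] GS_gens by metis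
    have "\<phi> (b \<circ> a\<inverse> \<circ> b\<inverse> \<circ> a) = gs_gamma \<circ> gs_x\<inverse> \<circ> gs_gamma\<inverse> \<circ> gs_x"
      using ab phi by simp
    moreover have "b \<circ> a\<inverse> \<circ> b\<inverse> \<circ> a \<in> B" using ab by (simp add: B_def)
    ultimately show "gs_gamma \<circ> gs_x\<inverse> \<circ> gs_gamma\<inverse> \<circ> gs_x \<in> \<phi> ` B" by (metis imageI)
  qed
  obtain r s where rs: "r \<in> rist 0" "r \<noteq> id" "s \<in> rist 1" "s \<noteq> id"
    using rist_nontrivial by meson
  have "\<phi> s = id"
  proof (rule centralizer_trivial[OF M \<open>GS' \<subseteq> \<phi> ` B\<close>])
    show "\<phi> g \<in> \<phi> ` B" using g by (simp add: B_def)
    show "xexp (\<phi> g) \<noteq> 0" by fact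
    show "subgroup (\<phi> ` rist 0) gupta_sidki"
      using phi subgroup_rist by (rule aut_image_subgroup)
    show "h \<circ> n \<circ> h\<inverse> \<in> \<phi> ` rist 0" if "h \<in> \<phi> ` B" "n \<in> \<phi> ` rist 0" for h n
    proof (rule conj[OF that])
      show "a \<circ> n \<circ> a\<inverse> \<in> rist 0" if "a \<in> B" "n \<in> rist 0" for a n
        using that rist_conj[of a n 0] by (simp add: B_def GS_rt)
    qed (auto simp: B_def ristD)
    show "\<phi> r \<in> \<phi> ` rist 0" using rs by simp
    show "\<phi> r \<noteq> id" using rs phi by (simp add: aut_eq_id ristD)
    show "\<phi> s \<in> GS" using rs phi by (simp add: ristD)
    show "\<phi> s \<circ> n = n \<circ> \<phi> s" if n: "n \<in> \<phi> ` rist 0" for n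
    proof -
      obtain k where k: "k \<in> rist 0" "n = \<phi> k" using n by blast
      then show ?thesis using rist_commute[of 1 0 s k] rs
          aut_comp[OF phi ristD(1)[OF rs(3)] ristD(1)[OF k(1)]]
          aut_comp[OF phi ristD(1)[OF k(1)] ristD(1)[OF rs(3)]] by simp
    qed
  qed
  then show False using rs phi by (simp add: aut_eq_id ristD)
qed

lemma aut_stab:
  assumes phi: "aut \<phi>" and g: "g \<in> GS"
  shows "xexp (\<phi> g) = 0 \<longleftrightarrow> xexp g = 0"
proof
  assume "xexp (\<phi> g) = 0"
  moreover have "aut (inv_into GS \<phi>)"
    using group.iso_set_sym[OF group_gupta_sidki phi] .
  moreover have "inv_into GS \<phi> (\<phi> g) = g"
    using phi g by (simp add: aut_iff bij_betw_def)
  ultimately show "xexp g = 0" using aut_stab_imp[of "inv_into GS \<phi>" "\<phi> g"] phi g by simp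
qed (rule aut_stab_imp[OF assms])

text \<open>The sections at \<open>i\<close> of \<open>\<phi>(rist c)\<close> form a normal subgroup of \<open>G\<close>: conjugation by an element \<open>h\<close> of \<open>G\<close> is
achieved by lifting \<open>h\<close> to the level stabilizer, which \<open>\<phi>\<close> maps onto itself, and \<open>rist c\<close> is normal in
the level stabilizer. So \<open>centralizer_trivial\<close> applies to this subgroup as soon as it is
nontrivial.\<close>

lemma rist_section_centralizer:
  assumes phi: "aut \<phi>" and g: "g \<in> rist c" "sec (\<phi> g) i \<noteq> id"
    and y: "y \<in> GS" and comm: "\<And>g. g \<in> rist c \<Longrightarrow> y \<circ> sec (\<phi> g) i = sec (\<phi> g) i \<circ> y"
  shows "y = id"
proof (rule centralizer_trivial[where M = GS and m = gs_x and X = "(\<lambda>g. sec (\<phi> g) i) ` rist c"])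
  have x0: "xexp (\<phi> g) = 0" if "g \<in> rist c" for g
    using that phi by (simp add: aut_stab ristD)
  have rt: "rt (\<phi> g) i = i" if "g \<in> rist c" for g
    using x0[OF that] that phi by (simp add: GS_rt ristD)
  show "subgroup GS gupta_sidki" by (auto simp: GS_subgroup_iff)
  show "GS' \<subseteq> GS" by auto
  show "gs_x \<in> GS" "xexp gs_x \<noteq> 0" by simp_all
  have R: "id \<in> rist c" "f \<circ> g \<in> rist c" "f\<inverse> \<in> rist c" if "f \<in> rist c" "g \<in> rist c" for f g
    using subgroup_rist that by (auto simp: GS_subgroup_iff)
  show "subgroup ((\<lambda>g. sec (\<phi> g) i) ` rist c) gupta_sidki"
    unfolding GS_subgroup_iff
  proof (intro conjI ballI)
    show "(\<lambda>g. sec (\<phi> g) i) ` rist c \<subseteq> GS" using phi by (auto simp: ristD)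
    show "id \<in> (\<lambda>g. sec (\<phi> g) i) ` rist c"
      using R(1)[OF g(1) g(1)] phi by (intro image_eqI[of _ _ id]) simp_all
    fix a assume "a \<in> (\<lambda>g. sec (\<phi> g) i) ` rist c"
    then obtain f where f: "f \<in> rist c" "a = sec (\<phi> f) i" by blast
    show "a\<inverse> \<in> (\<lambda>g. sec (\<phi> g) i) ` rist c"
      using f R(3)[OF f(1) f(1)] phi rt[OF f(1)] sec_inv_rt[of "\<phi> f" i]
      by (intro image_eqI[of _ _ "f\<inverse>"]) (simp_all add: ristD)
    fix b assume "b \<in> (\<lambda>g. sec (\<phi> g) i) ` rist c"
    then obtain g where g: "g \<in> rist c" "b = sec (\<phi> g) i" by blast
    show "a \<circ> b \<in> (\<lambda>g. sec (\<phi> g) i) ` rist c"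
      using f g R(2)[OF f(1) g(1)] phi rt[OF g(1)]
      by (intro image_eqI[of _ _ "f \<circ> g"]) (simp_all add: ristD)
  qed
  show "sec (\<phi> g) i \<in> (\<lambda>g. sec (\<phi> g) i) ` rist c" using g by simp
  show "h \<circ> n \<circ> h\<inverse> \<in> (\<lambda>g. sec (\<phi> g) i) ` rist c"
    if h: "h \<in> GS" and n: "n \<in> (\<lambda>g. sec (\<phi> g) i) ` rist c" for h n
  proof -
    obtain f where f: "f \<in> rist c" "n = sec (\<phi> f) i" using n by blast
    obtain z where z: "z \<in> GS" "xexp z = 0" "sec z i = h" using sec_stab_surj[OF h] by blast
    obtain k where k: "k \<in> GS" "\<phi> k = z" using aut_surj[OF phi z(1)] by blast
    have "xexp k = 0" using aut_stab[OF phi k(1)] z k by simp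
    then have "k \<circ> f \<circ> k\<inverse> \<in> rist c" using rist_conj[OF k(1) f(1)] k by (simp add: GS_rt)
    moreover have "sec (\<phi> (k \<circ> f \<circ> k\<inverse>)) i = h \<circ> n \<circ> h\<inverse>"
    proof -
      have r: "rt z i = i" "rt (z\<inverse>) i = i" "rt (\<phi> f) i = i"
        using z rt[OF f(1)] by (simp_all add: GS_rt)
      have "\<phi> (k \<circ> f \<circ> k\<inverse>) = z \<circ> \<phi> f \<circ> z\<inverse>" using k f phi by (simp add: ristD)
      then show ?thesis using z f phi r by (simp add: sec_inv ristD)
    qed
    ultimately show ?thesis by (metis imageI)
  qed
qed (use g y comm in auto)

text \<open>Choose for each \<open>c\<close> a vertex \<open>\<tau> c\<close> at which \<open>\<phi>(rist c)\<close> has a nontrivial section. The images of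
different rigid stabilizers commute, so at the vertex \<open>\<tau> c\<close> all the others have trivial sections by
\<open>rist_section_centralizer\<close>. Hence \<open>\<tau>\<close> is injective, therefore onto, and so \<open>\<phi>(rist c)\<close> has nontrivial
sections at \<open>\<tau> c\<close> only.\<close>

lemma aut_permutes_rist:
  assumes phi: "aut \<phi>"
  shows "\<exists>\<tau>. bij \<tau> \<and> (\<forall>c. \<forall>g\<in>rist c. \<phi> g \<in> rist (\<tau> c))"
proof -
  have "\<exists>i. \<exists>g\<in>rist c. sec (\<phi> g) i \<noteq> id" for c
  proof -
    obtain g where g: "g \<in> rist c" "g \<noteq> id" using rist_nontrivial by blast
    then have "\<phi> g \<noteq> id" "xexp (\<phi> g) = 0" "\<phi> g \<in> GS"
      using phi by (simp_all add: aut_eq_id aut_stab ristD)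
    then have "\<exists>i. sec (\<phi> g) i \<noteq> id" using stab_eqI[of "\<phi> g" id] by auto
    with g show ?thesis by blast
  qed
  then obtain \<tau> where tau: "\<And>c. \<exists>g\<in>rist c. sec (\<phi> g) (\<tau> c) \<noteq> id" by metis
  have triv: "sec (\<phi> f) (\<tau> c) = id" if "f \<in> rist d" "d \<noteq> c" for c d f
  proof -
    obtain g where g: "g \<in> rist c" "sec (\<phi> g) (\<tau> c) \<noteq> id" using tau by blast
    show ?thesis
    proof (rule rist_section_centralizer[of \<phi> g c "\<tau> c" "sec (\<phi> f) (\<tau> c)", OF phi g])
      have f: "f \<in> GS" "xexp f = 0" using that(1) by (simp_all only: rist_def mem_Collect_eq)
      show "sec (\<phi> f) (\<tau> c) \<in> GS" using f(1) phi by simp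
      fix k assume k: "k \<in> rist c"
      then have k': "k \<in> GS" "xexp k = 0" by (simp_all only: rist_def mem_Collect_eq)
      have "\<phi> f \<circ> \<phi> k = \<phi> k \<circ> \<phi> f"
        using rist_commute[OF that(2,1) k] aut_comp[OF phi ristD(1)[OF that(1)] ristD(1)[OF k]]
          aut_comp[OF phi ristD(1)[OF k] ristD(1)[OF that(1)]] by simp
      then have "sec (\<phi> f \<circ> \<phi> k) (\<tau> c) = sec (\<phi> k \<circ> \<phi> f) (\<tau> c)" by simp
      moreover have "rt (\<phi> f) i = i" "rt (\<phi> k) i = i" for i
        using phi f k' by (simp_all add: GS_rt aut_stab)
      ultimately show "sec (\<phi> f) (\<tau> c) \<circ> sec (\<phi> k) (\<tau> c) = sec (\<phi> k) (\<tau> c) \<circ> sec (\<phi> f) (\<tau> c)"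
        using phi f k' by simp
    qed
  qed
  have "inj \<tau>"
  proof (rule injI, rule ccontr)
    fix c d assume "\<tau> c = \<tau> d" "c \<noteq> d"
    then show False using tau[of d] triv[of _ d c] by auto
  qed
  then have "bij \<tau>" using finite_letter by (simp add: bij_def finite_UNIV_inj_surj)
  moreover have "\<phi> g \<in> rist (\<tau> c)" if g: "g \<in> rist c" for c g
  proof -
    have "sec (\<phi> g) i = id" if "i \<noteq> \<tau> c" for i
    proof -
      obtain d where "i = \<tau> d" using \<open>bij \<tau>\<close> by (metis bij_pointE)
      with that triv[OF g, of d] show ?thesis by auto
    qed
    then show ?thesis using g phi by (simp add: rist_def aut_stab)
  qed
  ultimately show ?thesis by blast
qed

text \<open>The permutation of the first level and the three automorphisms of \<open>G\<close> that an automorphism induces.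
The value of \<open>section_aut \<phi> c\<close> at \<open>z\<close> is found by lifting \<open>z\<close> to the level stabilizer; \<open>section_aut_sec\<close>
shows that the lift does not matter.\<close>

definition root_perm :: "((letter list \<Rightarrow> letter list) \<Rightarrow> (letter list \<Rightarrow> letter list)) \<Rightarrow> letter \<Rightarrow> letter"
  where "root_perm \<phi> = (SOME \<tau>. bij \<tau> \<and> (\<forall>c. \<forall>g\<in>rist c. \<phi> g \<in> rist (\<tau> c)))"

definition section_aut :: "((letter list \<Rightarrow> letter list) \<Rightarrow> (letter list \<Rightarrow> letter list)) \<Rightarrow> letter
    \<Rightarrow> (letter list \<Rightarrow> letter list) \<Rightarrow> (letter list \<Rightarrow> letter list)"
  where "section_aut \<phi> c z = sec (\<phi> (SOME y. y \<in> GS \<and> xexp y = 0 \<and> sec y c = z)) (root_perm \<phi> c)"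

lemma bij_perm: "aut \<phi> \<Longrightarrow> bij (root_perm \<phi>)"
  and perm_rist: "aut \<phi> \<Longrightarrow> g \<in> rist c \<Longrightarrow> \<phi> g \<in> rist (root_perm \<phi> c)"
  using someI_ex[OF aut_permutes_rist[of \<phi>]] unfolding root_perm_def by blast+

text \<open>For \<open>y\<close> in the level stabilizer, \<open>sec y c = id\<close> can be expressed without reference to the tree: it
means that \<open>y\<close> commutes with \<open>rist c\<close>.\<close>

lemma section_trivial_iff:
  assumes phi: "aut \<phi>" and y: "y \<in> GS" "xexp y = 0"
  shows "sec (\<phi> y) (root_perm \<phi> c) = id \<longleftrightarrow> sec y c = id"
proof
  obtain g where g: "g \<in> rist c" "g \<noteq> id" using rist_nontrivial by blast
  have r: "rt y i = i" "rt (\<phi> y) i = i" for i using phi y by (simp_all add: GS_rt aut_stab)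
  { assume e: "sec (\<phi> y) (root_perm \<phi> c) = id"
    show "sec y c = id"
    proof (rule rist_section_centralizer[OF aut_id g(1)])
      have "sec g c \<noteq> id"
        using g rist_eqI[OF g(1), of id] subgroup_rist[of c] by (auto simp: GS_subgroup_iff)
      then show "sec (id g) c \<noteq> id" by (metis id_apply)
      show "sec y c \<in> GS" using y by simp
      fix k assume k: "k \<in> rist c"
      have "\<phi> y \<circ> \<phi> k = \<phi> k \<circ> \<phi> y"
        using stab_rist_commute[OF _ _ e perm_rist[OF phi k]] phi y by (simp add: aut_stab)
      then have "\<phi> (y \<circ> k) = \<phi> (k \<circ> y)" using phi y k by (simp add: ristD)
      then have "y \<circ> k = k \<circ> y"
        using y ristD(1)[OF k] aut_inj[OF phi, of "y \<circ> k" "k \<circ> y"] by (simp del: aut_comp)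
      then have "sec (y \<circ> k) c = sec (k \<circ> y) c" by simp
      then show "sec y c \<circ> sec (id k) c = sec (id k) c \<circ> sec y c"
        using y k r by (simp add: ristD GS_rt id_apply)
    qed }
  { assume e: "sec y c = id"
    show "sec (\<phi> y) (root_perm \<phi> c) = id"
    proof (rule rist_section_centralizer[OF phi g(1)])
      have "\<phi> g \<noteq> id" using g phi by (simp add: aut_eq_id ristD)
      then show "sec (\<phi> g) (root_perm \<phi> c) \<noteq> id"
        using rist_eqI[OF perm_rist[OF phi g(1)], of id] subgroup_rist
        by (auto simp: GS_subgroup_iff)
      show "sec (\<phi> y) (root_perm \<phi> c) \<in> GS" using phi y by simp
      fix k assume k: "k \<in> rist c"
      have "\<phi> y \<circ> \<phi> k = \<phi> k \<circ> \<phi> y"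
        using stab_rist_commute[OF y e k] aut_comp[OF phi y(1) ristD(1)[OF k]]
          aut_comp[OF phi ristD(1)[OF k] y(1)] by simp
      then have "sec (\<phi> y \<circ> \<phi> k) (root_perm \<phi> c) = sec (\<phi> k \<circ> \<phi> y) (root_perm \<phi> c)" by simp
      then show "sec (\<phi> y) (root_perm \<phi> c) \<circ> sec (\<phi> k) (root_perm \<phi> c)
          = sec (\<phi> k) (root_perm \<phi> c) \<circ> sec (\<phi> y) (root_perm \<phi> c)"
        using phi y k r perm_rist[OF phi k] by (simp add: ristD GS_rt)
    qed }
qed

lemma section_eq_iff:
  assumes phi: "aut \<phi>" and y: "y \<in> GS" "xexp y = 0" and z: "z \<in> GS" "xexp z = 0"
  shows "sec (\<phi> y) (root_perm \<phi> c) = sec (\<phi> z) (root_perm \<phi> c) \<longleftrightarrow> sec y c = sec z c"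
proof -
  have eq: "f \<circ> g\<inverse> = id \<longleftrightarrow> f = g" if "ta f" "ta g" for f g
    using that by (metis comp_assoc comp_id id_comp ta_inv_cancel(1,2))
  have r: "rt (z\<inverse>) i = i" "rt ((\<phi> z)\<inverse>) i = i" for i using phi z by (simp_all add: GS_rt aut_stab)
  have "sec (\<phi> (y \<circ> z\<inverse>)) (root_perm \<phi> c) = id \<longleftrightarrow> sec (y \<circ> z\<inverse>) c = id"
    using y z by (intro section_trivial_iff[OF phi]) simp_all
  moreover have "sec (\<phi> (y \<circ> z\<inverse>)) (root_perm \<phi> c) = sec (\<phi> y) (root_perm \<phi> c) \<circ> (sec (\<phi> z) (root_perm \<phi> c))\<inverse>"
    using phi y z r by (simp add: sec_inv)
  moreover have "sec (y \<circ> z\<inverse>) c = sec y c \<circ> (sec z c)\<inverse>" using y z r by (simp add: sec_inv)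
  ultimately show ?thesis using eq phi y z by simp
qed

lemma section_aut_sec:
  assumes phi: "aut \<phi>" and y: "y \<in> GS" "xexp y = 0"
  shows "section_aut \<phi> c (sec y c) = sec (\<phi> y) (root_perm \<phi> c)"
proof -
  define z where "z = (SOME z. z \<in> GS \<and> xexp z = 0 \<and> sec z c = sec y c)"
  have "z \<in> GS \<and> xexp z = 0 \<and> sec z c = sec y c"
    unfolding z_def by (rule someI[of _ y]) (use y in simp)
  then show ?thesis unfolding section_aut_def z_def[symmetric]
    using section_eq_iff[OF phi _ _ y] by simp
qed

lemma aut_section_aut:
  assumes phi: "aut \<phi>"
  shows "aut (section_aut \<phi> c)"
  unfolding aut_iff
proof (intro conjI ballI)
  have lift: "\<exists>y\<in>GS. xexp y = 0 \<and> sec y c = z" if "z \<in> GS" for z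
    using sec_stab_surj[OF that] .
  show "bij_betw (section_aut \<phi> c) GS GS" unfolding bij_betw_def
  proof (intro conjI inj_onI subset_antisym subsetI)
    fix f g assume fg: "f \<in> GS" "g \<in> GS" "section_aut \<phi> c f = section_aut \<phi> c g"
    obtain y z where "y \<in> GS" "xexp y = 0" "sec y c = f" "z \<in> GS" "xexp z = 0" "sec z c = g"
      using lift fg(1,2) by metis
    then show "f = g" using fg(3) section_eq_iff[OF phi] section_aut_sec[OF phi] by metis
  next
    fix h assume "h \<in> section_aut \<phi> c ` GS"
    then obtain y where "y \<in> GS" "xexp y = 0" "h = section_aut \<phi> c (sec y c)" using lift by fastforce
    then show "h \<in> GS" using phi by (simp add: section_aut_sec)
  next
    fix h assume "h \<in> GS"
    then obtain z where z: "z \<in> GS" "xexp z = 0" "sec z (root_perm \<phi> c) = h"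
      using sec_stab_surj by blast
    obtain y where y: "y \<in> GS" "\<phi> y = z" using aut_surj[OF phi z(1)] by blast
    then have "xexp y = 0" using aut_stab[OF phi] z by blast
    then have "h = section_aut \<phi> c (sec y c)" using y z phi by (simp add: section_aut_sec)
    then show "h \<in> section_aut \<phi> c ` GS" using y by simp
  qed
  fix f g assume "f \<in> GS" "g \<in> GS"
  then obtain y z where y: "y \<in> GS" "xexp y = 0" "sec y c = f" and z: "z \<in> GS" "xexp z = 0" "sec z c = g"
    using lift by metis
  have r: "rt z i = i" "rt (\<phi> z) i = i" for i using phi z by (simp_all add: GS_rt aut_stab)
  have "section_aut \<phi> c (f \<circ> g) = section_aut \<phi> c (sec (y \<circ> z) c)" using y z r by simp
  also have "\<dots> = sec (\<phi> (y \<circ> z)) (root_perm \<phi> c)" using y z by (intro section_aut_sec[OF phi]) simp_all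
  also have "\<dots> = section_aut \<phi> c f \<circ> section_aut \<phi> c g"
    using section_aut_sec[OF phi y(1,2), of c] section_aut_sec[OF phi z(1,2), of c] phi y z r by simp
  finally show "section_aut \<phi> c (f \<circ> g) = section_aut \<phi> c f \<circ> section_aut \<phi> c g" .
qed

text \<open>The tree automorphism that induces \<open>\<phi>\<close>. Its section at \<open>c\<close> is again of this form, for the automorphism
\<open>section_aut \<phi> c\<close>; the recursion therefore runs over all automorphisms at once.\<close>

fun tree_map :: "((letter list \<Rightarrow> letter list) \<Rightarrow> (letter list \<Rightarrow> letter list)) \<Rightarrow> letter list \<Rightarrow> letter list"
  where
  "tree_map \<phi> [] = []"
| "tree_map \<phi> (c # s) = root_perm \<phi> c # tree_map (section_aut \<phi> c) s"

lemma ta_tree_map: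
  assumes "aut \<phi>"
  shows "ta (tree_map \<phi>)"
  unfolding tree_automorphism_def
proof (intro conjI allI)
  have pinj: "root_perm \<phi> c = root_perm \<phi> d \<longleftrightarrow> c = d" if "aut \<phi>" for \<phi> c d
    using bij_perm[OF that] by (metis bij_pointE)
  have Nil: "tree_map \<phi> u = [] \<longleftrightarrow> u = []" for \<phi> u by (cases u) auto
  show "tree_map \<phi> [] = []" by simp
  have "inj (tree_map \<phi>)"
  proof (rule injI)
    fix u v assume "tree_map \<phi> u = tree_map \<phi> v"
    then show "u = v" using \<open>aut \<phi>\<close>
    proof (induction u arbitrary: v \<phi>)
      case Nil then show ?case by (cases v) auto
    next
      case (Cons c u)
      then obtain d w where "v = d # w" by (cases v) auto
      with Cons show ?case by (auto simp: pinj intro: aut_section_aut)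
    qed
  qed
  moreover have "\<exists>u. tree_map \<phi> u = v" for v
    using \<open>aut \<phi>\<close>
  proof (induction v arbitrary: \<phi>)
    case Nil then show ?case by (metis tree_map.simps(1))
  next
    case (Cons d v)
    obtain c where "root_perm \<phi> c = d" using bij_perm[OF Cons.prems] by (metis bij_pointE)
    moreover obtain u where "tree_map (section_aut \<phi> c) u = v"
      using Cons.IH[OF aut_section_aut[OF Cons.prems]] by blast
    ultimately have "tree_map \<phi> (c # u) = d # v" by simp
    then show ?case by blast
  qed
  ultimately show "bij (tree_map \<phi>)" by (metis bijI surjI)
  have single: "(\<exists>c. tree_map \<phi> v = [c]) \<longleftrightarrow> (\<exists>c. v = [c])" for v \<phi>
    by (cases v) (auto simp: Nil)
  show "tree_adj (tree_map \<phi> u) (tree_map \<phi> v) \<longleftrightarrow> tree_adj u v" for u v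
    using assms
  proof (induction u arbitrary: v \<phi>)
    case Nil then show ?case by (simp add: single)
  next
    case (Cons c u) then show ?case
      by (cases v) (auto simp: Nil pinj aut_section_aut)
  qed
qed

text \<open>The statement about two automorphisms and two group elements is what the induction on words needs:
going from \<open>c\<close> to the vertex \<open>rt g c\<close>, the automorphism \<open>section_aut \<phi> c\<close> is replaced by
\<open>section_aut \<psi> (rt g c)\<close>, and the two are again related by a pair of group elements, namely sections of
\<open>g\<close> and \<open>h\<close>. The case of interest is \<open>\<psi> = \<phi>\<close> and \<open>h = \<phi> g\<close>.\<close>

lemma tree_map_equivariant:
  assumes "aut \<phi>" "aut \<psi>" "g \<in> GS" "h \<in> GS"
    and "\<And>z. z \<in> GS \<Longrightarrow> \<psi> (g \<circ> z \<circ> g\<inverse>) = h \<circ> \<phi> z \<circ> h\<inverse>"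
  shows "tree_map \<psi> (g w) = h (tree_map \<phi> w)"
  using assms
proof (induction w arbitrary: \<phi> \<psi> g h)
  case Nil then show ?case by simp
next
  case (Cons c w)
  note a = Cons.prems
  have root_perm: "root_perm \<psi> (rt g c) = rt h (root_perm \<phi> c)"
  proof (rule ccontr)
    assume ne: "root_perm \<psi> (rt g c) \<noteq> rt h (root_perm \<phi> c)"
    obtain r where r: "r \<in> rist c" "r \<noteq> id" using rist_nontrivial by blast
    have "\<psi> (g \<circ> r \<circ> g\<inverse>) \<in> rist (root_perm \<psi> (rt g c))"
      using rist_conj[OF a(3) r(1)] by (rule perm_rist[OF a(2)])
    moreover have "\<psi> (g \<circ> r \<circ> g\<inverse>) \<in> rist (rt h (root_perm \<phi> c))"
      using rist_conj[OF a(4) perm_rist[OF a(1) r(1)]] a(5)[of r] r by (simp add: ristD)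
    ultimately have "\<psi> (g \<circ> r \<circ> g\<inverse>) = id" using ne rist_disjoint by blast
    then have e: "g \<circ> r \<circ> g\<inverse> = id" using a(2,3) r by (simp add: aut_eq_id ristD del: aut_comp)
    have "r = g\<inverse> \<circ> (g \<circ> r \<circ> g\<inverse>) \<circ> g" using a(3) by (simp add: comp_assoc)
    with r(2) show False using a(3) by (simp add: e)
  qed
  have "section_aut \<psi> (rt g c) (sec g c \<circ> z \<circ> (sec g c)\<inverse>)
      = sec h (root_perm \<phi> c) \<circ> section_aut \<phi> c z \<circ> (sec h (root_perm \<phi> c))\<inverse>" if z: "z \<in> GS" for z
  proof -
    obtain y where y: "y \<in> GS" "xexp y = 0" "sec y c = z" using sec_stab_surj[OF z] by blast
    have r: "rt y i = i" "rt (\<phi> y) i = i" for i using a(1) y by (simp_all add: GS_rt aut_stab)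
    have "sec (g \<circ> y \<circ> g\<inverse>) (rt g c) = sec g c \<circ> z \<circ> (sec g c)\<inverse>"
      using a(3) y r by simp
    then have "section_aut \<psi> (rt g c) (sec g c \<circ> z \<circ> (sec g c)\<inverse>)
        = sec (\<psi> (g \<circ> y \<circ> g\<inverse>)) (root_perm \<psi> (rt g c))"
      using section_aut_sec[OF a(2), of "g \<circ> y \<circ> g\<inverse>" "rt g c"] a(3) y by simp
    also have "\<dots> = sec (h \<circ> \<phi> y \<circ> h\<inverse>) (rt h (root_perm \<phi> c))"
      using a(5)[OF y(1)] root_perm by simp
    also have "\<dots> = sec h (root_perm \<phi> c) \<circ> sec (\<phi> y) (root_perm \<phi> c) \<circ> (sec h (root_perm \<phi> c))\<inverse>"
      using a(1,4) y r by simp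
    finally show ?thesis using section_aut_sec[OF a(1) y(1,2), of c] y by simp
  qed
  then have "tree_map (section_aut \<psi> (rt g c)) (sec g c w) = sec h (root_perm \<phi> c) (tree_map (section_aut \<phi> c) w)"
    using a by (intro Cons.IH) (simp_all add: aut_section_aut)
  then show ?case using a root_perm by (simp add: ta_Cons)
qed

proposition aut_is_conjugation:
  assumes phi: "aut \<phi>"
  shows "\<exists>t. ta t \<and> (\<forall>g\<in>GS. \<phi> g = t \<circ> g \<circ> t\<inverse>)"
proof (intro exI conjI ballI)
  show t: "ta (tree_map \<phi>)" using phi by (rule ta_tree_map)
  fix g assume g: "g \<in> GS"
  have "tree_map \<phi> (g w) = \<phi> g (tree_map \<phi> w)" for w
    using g phi by (intro tree_map_equivariant) simp_all
  then have "tree_map \<phi> \<circ> g = \<phi> g \<circ> tree_map \<phi>" by (simp add: fun_eq_iff comp_apply)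
  then show "\<phi> g = tree_map \<phi> \<circ> g \<circ> (tree_map \<phi>)\<inverse>" using t g phi by (simp add: comp_assoc)
qed

section \<open>The action of normalizing tree automorphisms on the exponents\<close>

definition normalizing :: "(letter list \<Rightarrow> letter list) \<Rightarrow> bool"
  where "normalizing t \<longleftrightarrow> ta t \<and> (\<forall>g\<in>GS. t \<circ> g \<circ> t\<inverse> \<in> GS)"

lemma normalizing_ta [simp]: "normalizing t \<Longrightarrow> ta t"
  and normalizing_conj: "normalizing t \<Longrightarrow> g \<in> GS \<Longrightarrow> t \<circ> g \<circ> t\<inverse> \<in> GS"
  by (simp_all add: normalizing_def)

text \<open>Every permutation of the first level is an affine map of the field with three elements. Its slope
\<open>xsign t\<close> is its sign. Conjugation by \<open>t\<close> multiplies \<open>xexp\<close> by \<open>xsign t\<close> and \<open>gexp\<close> by \<open>gsign t\<close>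
(\<open>xexp_conj\<close>, \<open>gexp_conj\<close>).\<close>

definition xsign :: "(letter list \<Rightarrow> letter list) \<Rightarrow> letter"
  where "xsign t = rt t 1 - rt t 0"

definition gsign :: "(letter list \<Rightarrow> letter list) \<Rightarrow> letter"
  where "gsign t = gexp (t \<circ> gs_gamma \<circ> t\<inverse>)"

lemma rt_affine:
  assumes "ta t" shows "rt t c = xsign t * c + rt t 0"
proof -
  have "rt t 0 \<noteq> rt t 1" "rt t 0 \<noteq> rt t (-1)" "rt t 1 \<noteq> rt t (-1)"
    using assms by (simp_all add: rt_inj letter_distinct)
  then show ?thesis using letter_cases[of c]
    by (cases "rt t 0"; cases "rt t 1"; cases "rt t (-1)")
       (auto simp: xsign_def letter_defs)
qed

lemma xsign_cases: "ta t \<Longrightarrow> xsign t = 1 \<or> xsign t = -1"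
  using letter_cases[of "xsign t"] rt_inj[of t 1 0] by (auto simp: xsign_def)

lemma xsign_square: "ta t \<Longrightarrow> xsign t * xsign t = 1"
  using xsign_cases by fastforce

lemma xexp_conj:
  assumes t: "normalizing t" and g: "g \<in> GS"
  shows "xexp (t \<circ> g \<circ> t\<inverse>) = xsign t * xexp g"
proof -
  define d where "d = rt (t\<inverse>) 0"
  have "rt t d = 0" using t by (simp add: d_def)
  then have d: "xsign t * d + rt t 0 = 0" using rt_affine[of t d] t by simp
  have "xexp (t \<circ> g \<circ> t\<inverse>) = rt t (d + xexp g)"
    using t g by (simp add: xexp_def[of "t \<circ> g \<circ> t\<inverse>"] GS_rt d_def)
  also have "\<dots> = xsign t * (d + xexp g) + rt t 0" using rt_affine[of t "d + xexp g"] t by simp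
  finally show ?thesis using d by (simp add: algebra_simps)
qed

text \<open>An element outside the level stabilizer cycles the first level, so each section of its cube is a
product of its three sections in some order, and this product has exponent \<open>gexp h\<close>.\<close>

lemma gexp_order_3:
  assumes h: "h \<in> GS" "xexp h \<noteq> 0" "h \<circ> (h \<circ> h) = id"
  shows "gexp h = 0"
proof -
  let ?l = "xexp h"
  have "sec (h \<circ> (h \<circ> h)) 0 = sec h (?l + ?l) \<circ> (sec h ?l \<circ> sec h 0)"
    using h(1) by (simp add: GS_rt)
  then have "sec h (?l + ?l) \<circ> (sec h ?l \<circ> sec h 0) = id"
    unfolding h(3) sec_id by (rule sym)
  then have "gexp (sec h (?l + ?l) \<circ> (sec h ?l \<circ> sec h 0)) = 0" by simp
  then have "gexp (sec h (?l + ?l)) + (gexp (sec h ?l) + gexp (sec h 0)) = 0" using h(1) by simp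
  then show ?thesis
    using gexp_sec_sum[OF h(1)] h(2) letter_cases[of ?l]
    by (auto simp: letter_double letter_double' add_ac)
qed

text \<open>Conjugation by \<open>t\<close> followed by \<open>gexp\<close> is a homomorphism and thus determined on generators; it vanishes on
\<open>x\<close> by \<open>gexp_order_3\<close>.\<close>

lemma gexp_conj:
  assumes t: "normalizing t" and g: "g \<in> GS"
  shows "gexp (t \<circ> g \<circ> t\<inverse>) = gsign t * gexp g"
proof -
  have split: "t \<circ> (f \<circ> g) \<circ> t\<inverse> = (t \<circ> f \<circ> t\<inverse>) \<circ> (t \<circ> g \<circ> t\<inverse>)" for f g
    using t by (simp add: comp_assoc)
  have x0: "gexp (t \<circ> gs_x \<circ> t\<inverse>) = 0"
  proof (rule gexp_order_3)
    show "t \<circ> gs_x \<circ> t\<inverse> \<in> GS" using t by (intro normalizing_conj) simp_all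
    show "xexp (t \<circ> gs_x \<circ> t\<inverse>) \<noteq> 0" using t xsign_cases[of t] by (auto simp: xexp_conj)
    show "t \<circ> gs_x \<circ> t\<inverse> \<circ> (t \<circ> gs_x \<circ> t\<inverse> \<circ> (t \<circ> gs_x \<circ> t\<inverse>)) = id"
      using t by (simp add: comp_assoc gs_x_sq)
  qed
  show ?thesis using g
  proof (induction rule: GS_induct)
    case one
    then show ?case using t by simp
  next
    case (x g)
    then show ?case unfolding split[of gs_x g]
      using x0 normalizing_conj[OF t] by simp
  next
    case (gamma g)
    then show ?case unfolding split[of gs_gamma g]
      using normalizing_conj[OF t] by (simp add: gsign_def[symmetric] distrib_left)
  qed
qed

lemma sec_conj:
  assumes t: "ta t" and y: "y \<in> GS" "xexp y = 0"
  shows "sec (t \<circ> y \<circ> t\<inverse>) (rt t c) = sec t c \<circ> sec y c \<circ> (sec t c)\<inverse>"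
  using t y by (simp add: GS_rt)

lemma normalizing_sec [simp]:
  assumes t: "normalizing t"
  shows "normalizing (sec t c)"
  unfolding normalizing_def
proof (intro conjI ballI)
  fix g assume "g \<in> GS"
  then obtain y where y: "y \<in> GS" "xexp y = 0" "sec y c = g" using sec_stab_surj by blast
  have "sec (t \<circ> y \<circ> t\<inverse>) (rt t c) \<in> GS" using normalizing_conj[OF t y(1)] by (rule GS_sec)
  then show "sec t c \<circ> g \<circ> (sec t c)\<inverse> \<in> GS" using sec_conj[of t y c] t y by simp
qed (use t in simp)

text \<open>Conjugate by \<open>t\<close> an element of the level stabilizer whose sections have prescribed \<open>gexp\<close>, namely \<open>v\<close>. The
sections of the result must satisfy the relation \<open>xexp_sec\<close>, too. As \<open>v\<close> is arbitrary, this
ties together the signs of the three sections of \<open>t\<close>.\<close>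

lemma sign_relation:
  assumes t: "normalizing t"
  defines "\<delta> \<equiv> xsign t"
  shows "xsign (sec t c) * (v (c - 1) - v (c + 1))
    = gsign (sec t (c - \<delta>)) * v (c - \<delta>) - gsign (sec t (c + \<delta>)) * v (c + \<delta>)"
    and "\<exists>z\<in>GS. gexp z = gsign t * (v (-1) + v 0 + v 1) \<and> (\<forall>d. gexp (sec z (rt t d)) = gsign (sec t d) * v d)"
proof -
  obtain y where y: "y \<in> GS" "xexp y = 0" "\<And>d. gexp (sec y d) = v d"
    using stab_with_gexps by blast
  define z where "z = t \<circ> y \<circ> t\<inverse>"
  have z: "z \<in> GS" "xexp z = 0" "gexp z = gsign t * gexp y"
    using normalizing_conj[OF t y(1)] t y by (simp_all add: z_def xexp_conj gexp_conj)
  have s: "sec z (rt t d) = sec t d \<circ> sec y d \<circ> (sec t d)\<inverse>" for d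
    using sec_conj[of t y d] t y by (simp add: z_def)
  have g: "gexp (sec z (rt t d)) = gsign (sec t d) * v d" for d
    using t y by (simp add: s gexp_conj)
  have x: "xexp (sec z (rt t d)) = xsign (sec t d) * (v (d - 1) - v (d + 1))" for d
    using t y xexp_sec[OF y(1), of d] by (simp add: s xexp_conj)
  have "xsign t * xsign t = 1" using t by (simp add: xsign_square)
  then have "rt t c - 1 = rt t (c - \<delta>)" "rt t c + 1 = rt t (c + \<delta>)"
    using rt_affine[of t c] rt_affine[of t "c - \<delta>"] rt_affine[of t "c + \<delta>"] t
    by (simp_all add: \<delta>_def algebra_simps)
  then show "xsign (sec t c) * (v (c - 1) - v (c + 1))
    = gsign (sec t (c - \<delta>)) * v (c - \<delta>) - gsign (sec t (c + \<delta>)) * v (c + \<delta>)"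
    using xexp_sec[OF z(1), of "rt t c"] by (simp add: x g)
  show "\<exists>z\<in>GS. gexp z = gsign t * (v (-1) + v 0 + v 1) \<and> (\<forall>d. gexp (sec z (rt t d)) = gsign (sec t d) * v d)"
    using z g gexp_sec_sum[OF y(1)] by (intro bexI[of _ z]) (simp_all add: y(3))
qed

lemma sec_signs:
  assumes t: "normalizing t"
  shows gsign_sec: "gsign (sec t c) = gsign t"
    and xsign_sec: "xsign (sec t c) = xsign t * gsign t"
proof -
  show g: "gsign (sec t c) = gsign t" for c
  proof -
    \<comment> \<open>Let only the section at \<open>c\<close> have nonzero \<open>gexp\<close> and compare the totals before and after conjugation.\<close>
    obtain z where z: "z \<in> GS" "gexp z = gsign t"
      "\<And>d. gexp (sec z (rt t d)) = (if d = c then gsign (sec t d) else 0)"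
      using sign_relation(2)[OF t, of "\<lambda>d. if d = c then 1 else 0"] letter_cases[of c]
      by (auto simp: letter_distinct if_distrib cong: if_cong)
    have "gexp (sec z e) = (if e = rt t c then gsign (sec t c) else 0)" for e
      using z(3)[of "rt (t\<inverse>) e"] t by auto
    then have "gexp z = gsign (sec t c)"
      using gexp_sec_sum[OF z(1)] letter_cases[of "rt t c"] by (auto simp: letter_distinct)
    with z show ?thesis by simp
  qed
  \<comment> \<open>With \<open>v\<close> supported at \<open>c - 1\<close>, the left-hand side of the relation is \<open>xsign (sec t c)\<close>.\<close>
  have "xsign (sec t c) = xsign t * gsign t"
    using sign_relation(1)[OF t, of c "\<lambda>d. if d = c - 1 then 1 else 0"] xsign_cases[of t] t letter_cases[of c]
    by (auto simp: letter_distinct g letter_double letter_double')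
  then show "xsign (sec t c) = xsign t * gsign t" .
qed

lemma gsign_cases:
  assumes t: "normalizing t"
  shows "gsign t = 1 \<or> gsign t = -1"
  using xsign_sec[OF t, of 0] xsign_cases[of "sec t 0"] letter_cases[of "gsign t"] t
  by auto

lemma normalizing_comp: "normalizing s \<Longrightarrow> normalizing t \<Longrightarrow> normalizing (s \<circ> t)"
  and xsign_comp: "normalizing s \<Longrightarrow> normalizing t \<Longrightarrow> xsign (s \<circ> t) = xsign s * xsign t"
  and gsign_comp: "normalizing s \<Longrightarrow> normalizing t \<Longrightarrow> gsign (s \<circ> t) = gsign s * gsign t"
proof -
  assume s: "normalizing s" and t: "normalizing t"
  have e: "s \<circ> t \<circ> g \<circ> (s \<circ> t)\<inverse> = s \<circ> (t \<circ> g \<circ> t\<inverse>) \<circ> s\<inverse>" for g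
    using s t by (simp add: ta_inv_comp comp_assoc)
  show "normalizing (s \<circ> t)" unfolding normalizing_def e using s t
    by (auto intro!: normalizing_conj)
  show "xsign (s \<circ> t) = xsign s * xsign t"
    using s t rt_affine[of s "rt t 0"] rt_affine[of s "rt t 1"]
    by (simp add: xsign_def[of "s \<circ> t"] xsign_def[of t] right_diff_distrib)
  show "gsign (s \<circ> t) = gsign s * gsign t"
    unfolding gsign_def[of "s \<circ> t"] e
    using s t by (simp add: gexp_conj normalizing_conj flip: gsign_def)
qed

section \<open>The depth of fixed vertices in a coset\<close>

text \<open>The fixed vertices form a subtree, so \<open>n\<close> is the largest level that contains one of them.\<close>

definition fixes_to :: "(letter list \<Rightarrow> letter list) \<Rightarrow> nat \<Rightarrow> bool"
  where "fixes_to s n \<longleftrightarrow> (\<exists>w. length w = n \<and> s w = w) \<and> (\<forall>w. length w = Suc n \<longrightarrow> s w \<noteq> w)"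

lemma fixes_to_beyond:
  assumes "ta s" "fixes_to s n" "n < length w"
  shows "s w \<noteq> w"
proof -
  have "w = take (Suc n) w @ drop (Suc n) w" "length (take (Suc n) w) = Suc n"
    using assms(3) by simp_all
  then show ?thesis using assms(1,2) ta_append_move unfolding fixes_to_def by metis
qed

lemma fixes_to_unique: "ta s \<Longrightarrow> fixes_to s m \<Longrightarrow> fixes_to s n \<Longrightarrow> m = n"
  using fixes_to_beyond unfolding fixes_to_def by (metis linorder_neqE_nat)

lemma fixes_to_conj:
  assumes g: "ta g" and s: "ta s" "fixes_to s n"
  shows "fixes_to (g \<circ> s \<circ> g\<inverse>) n"
  unfolding fixes_to_def
proof (intro conjI allI impI)
  obtain w where "length w = n" "s w = w" using s(2) by (auto simp: fixes_to_def)
  then show "\<exists>w. length w = n \<and> (g \<circ> s \<circ> g\<inverse>) w = w"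
    using g by (intro exI[of _ "g w"]) (simp add: comp_apply)
  fix w :: "letter list" assume "length w = Suc n"
  then have "s (g\<inverse> w) \<noteq> g\<inverse> w" using s(2) g by (simp add: fixes_to_def)
  then show "(g \<circ> s \<circ> g\<inverse>) w \<noteq> w" using g by (metis comp_apply ta_inv_apply(1))
qed

lemma fixes_to_0: "ta s \<Longrightarrow> (\<And>c. rt s c \<noteq> c) \<Longrightarrow> fixes_to s 0"
  by (auto simp: fixes_to_def length_Suc_conv ta_single)

lemma fixes_to_Suc:
  assumes s: "ta s" and c: "rt s c = c" "fixes_to (sec s c) n"
    and le: "\<And>d. rt s d = d \<Longrightarrow> \<exists>m\<le>n. fixes_to (sec s d) m"
  shows "fixes_to s (Suc n)"
  unfolding fixes_to_def
proof (intro conjI allI impI)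
  obtain w where "length w = n" "sec s c w = w" using c(2) by (auto simp: fixes_to_def)
  then show "\<exists>w. length w = Suc n \<and> s w = w"
    using s c(1) by (intro exI[of _ "c # w"]) (simp add: ta_Cons)
  fix w :: "letter list" assume "length w = Suc (Suc n)"
  then obtain d v where w: "w = d # v" "length v = Suc n" by (auto simp: length_Suc_conv)
  show "s w \<noteq> w"
  proof
    assume "s w = w"
    then have d: "rt s d = d" "sec s d v = v" using s w by (simp_all add: ta_Cons)
    then obtain m where "m \<le> n" "fixes_to (sec s d) m" using le by blast
    then show False using fixes_to_beyond[of "sec s d" m v] s d w by simp
  qed
qed

text \<open>Elements of \<open>G t\<close> are written with a power of \<open>x\<close> that adjusts the permutation of the first level,
followed by an element \<open>y\<close> of the level stabilizer that adjusts the sections.\<close>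

lemma
  assumes "y \<in> GS" "xexp y = 0" "ta t"
  shows rt_shift: "rt (y \<circ> lpow gs_x i \<circ> t) c = rt t c + i"
    and sec_shift: "sec (y \<circ> lpow gs_x i \<circ> t) c = sec y (rt t c + i) \<circ> sec t c"
proof -
  have s: "sec (lpow gs_x i) c = id" for c by (simp add: lpow_def sec_inv)
  show "rt (y \<circ> lpow gs_x i \<circ> t) c = rt t c + i"
    "sec (y \<circ> lpow gs_x i \<circ> t) c = sec y (rt t c + i) \<circ> sec t c"
    using assms by (simp_all add: GS_rt s)
qed

lemma fixes_to_0_exists:
  assumes t: "ta t" "xsign t = 1"
  shows "\<exists>x\<in>GS. fixes_to (x \<circ> t) 0"
proof (intro bexI)
  show "fixes_to (id \<circ> lpow gs_x (1 - rt t 0) \<circ> t) 0"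
  proof (rule fixes_to_0)
    show "rt (id \<circ> lpow gs_x (1 - rt t 0) \<circ> t) c \<noteq> c" for c
      using t rt_affine[of t c] by (simp add: rt_shift del: rt_comp id_comp)
  qed (use t in simp)
qed simp

text \<open>The section at the vertex \<open>0\<close> is provided by the induction hypothesis as \<open>h t\<^sub>0\<close>, which fixes
vertices to depth \<open>n\<close>. With \<open>h\<close> given, the solutions of the relation \<open>xexp_sec\<close> form a one-parameter
family. The parameter \<open>b\<close> is the \<open>gexp\<close> at the vertex \<open>-1\<close>; each of the vertices \<open>1\<close> and \<open>-1\<close> excludes one of
its three values, the one for which the children of that vertex are fixed.\<close>

lemma fixes_to_even:
  assumes "normalizing t" "xsign t = 1" "gsign t = 1"
  shows "\<exists>x\<in>GS. fixes_to (x \<circ> t) n"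
  using assms
proof (induction n arbitrary: t)
  case 0
  then show ?case by (intro fixes_to_0_exists) simp_all
next
  case (Suc n)
  note t = Suc.prems
  have "normalizing (sec t 0)" "xsign (sec t 0) = 1" "gsign (sec t 0) = 1"
    using t by (simp_all add: sec_signs)
  from Suc.IH[OF this] obtain h where h: "h \<in> GS" "fixes_to (h \<circ> sec t 0) n" by blast
  have "\<exists>b. b \<noteq> p \<and> b \<noteq> q" for p q :: letter
    by (cases p; cases q) (metis letter.distinct)+
  then obtain b where b: "b \<noteq> gexp h + rt (sec t 1) 0" "b \<noteq> xexp h + gexp h - rt (sec t (-1)) 0"
    by blast
  define v where "v d = (if d = 0 then gexp h else if d = 1 then b - xexp h else b)" for d :: letter
  obtain y where y: "y \<in> GS" "xexp y = 0" "sec y 0 = h" "\<And>d. gexp (sec y d) = v d"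
    using stab_with_section[OF h(1), of v 0] by (auto simp: v_def letter_distinct)
  define x where "x = y \<circ> lpow gs_x (- rt t 0)"
  define s where "s = x \<circ> t"
  have x: "x \<in> GS" using y by (simp add: x_def)
  have s: "ta s" "rt s c = c" "sec s c = sec y c \<circ> sec t c" for c
    using t y x rt_affine[of t c]
    by (simp_all add: s_def x_def rt_shift sec_shift del: rt_comp sec_comp)
  have "rt (sec s d) c \<noteq> c" if "d \<noteq> 0" for c d
  proof -
    have "rt (sec s d) c = c + rt (sec t d) 0 + (v (d - 1) - v (d + 1))"
      using t y rt_affine[of "sec t d" c] xexp_sec[OF y(1), of d]
      by (simp add: s GS_rt sec_signs)
    moreover have "rt (sec t d) 0 + (v (d - 1) - v (d + 1)) \<noteq> 0"
      using letter_cases[of d] that b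
      by (auto simp: v_def letter_distinct letter_double letter_double' algebra_simps)
    ultimately show ?thesis by (simp add: add.assoc)
  qed
  then have "fixes_to (sec s d) 0" if "d \<noteq> 0" for d
    using that s t y(1) by (intro fixes_to_0) simp_all
  then have "fixes_to s (Suc n)"
    using h y s(3)[of 0] by (intro fixes_to_Suc[OF s(1) s(2)[of 0]]) (simp, metis le0 order_refl)
  with x show ?case by (auto simp: s_def)
qed

text \<open>An odd permutation of the first level fixes a single vertex, and by \<open>derived_section\<close> multiplication by
elements of \<open>G'\<close> changes the section there by arbitrary elements of \<open>G\<close>.\<close>

lemma fixes_to_reflect:
  assumes t: "normalizing t" "xsign t = -1" and ex: "\<And>c. \<exists>x\<in>GS. fixes_to (x \<circ> sec t c) n"
  shows "\<exists>x\<in>GS'. fixes_to (x \<circ> t) (Suc n)"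
proof -
  define f where "f = - rt t 0"
  have f: "rt t c = c \<longleftrightarrow> c = f" for c
    using t(1) rt_affine[of t c] t(2)
    by (cases c; cases "rt t 0") (auto simp: f_def letter_defs)
  obtain h where h: "h \<in> GS" "fixes_to (h \<circ> sec t f) n" using ex by blast
  obtain y where y: "y \<in> GS'" "sec y f = h" using derived_section[OF h(1)] by blast
  then have y': "y \<in> GS" "xexp y = 0" by (simp_all add: GS'_def del: GS'_GS)
  have "fixes_to (y \<circ> t) (Suc n)"
  proof (rule fixes_to_Suc)
    show "ta (y \<circ> t)" "rt (y \<circ> t) f = f" "fixes_to (sec (y \<circ> t) f) n"
      using t y y' h f[of f] by (simp_all add: GS_rt)
    show "\<exists>m\<le>n. fixes_to (sec (y \<circ> t) d) m" if "rt (y \<circ> t) d = d" for d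
    proof -
      have "d = f" using that t y' f by (simp add: GS_rt)
      then show ?thesis using \<open>fixes_to (sec (y \<circ> t) f) n\<close> by auto
    qed
  qed
  with y show ?thesis by blast
qed

text \<open>The sections of \<open>t\<close> are odd and their sections even, so \<open>fixes_to_reflect\<close> leads from depth \<open>2 n\<close> to
\<open>2 n + 1\<close> for each section of \<open>t\<close>. It uses only elements of \<open>G'\<close>, and these can be chosen at the three
vertices independently of each other.\<close>

lemma fixes_to_alternating:
  assumes "normalizing t" "xsign t = 1" "gsign t = -1"
  shows "\<exists>x\<in>GS. fixes_to (x \<circ> t) (2 * n)"
  using assms
proof (induction n arbitrary: t)
  case 0
  then show ?case using fixes_to_0_exists by simp
next
  case (Suc n)
  note t = Suc.prems
  have "\<exists>x\<in>GS'. fixes_to (x \<circ> sec t c) (Suc (2 * n))" for c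
    using t by (intro fixes_to_reflect Suc.IH) (simp_all add: sec_signs)
  then obtain F where F: "\<And>c. F c \<in> GS'" "\<And>c. fixes_to (F c \<circ> sec t c) (Suc (2 * n))" by metis
  have F': "F c \<in> GS" "xexp (F c) = 0" "gexp (F c) = 0" for c
    using F(1)[of c] by (simp_all add: GS'_def del: GS'_GS)
  define x where "x = branch F \<circ> lpow gs_x (- rt t 0)"
  have "branch F \<in> GS" using F' by (intro branch_GS) simp_all
  then have x: "x \<in> GS" by (simp add: x_def)
  have s: "ta (x \<circ> t)" "rt (x \<circ> t) c = c" "sec (x \<circ> t) c = F c \<circ> sec t c" for c
    using t x \<open>branch F \<in> GS\<close> rt_affine[of t c]
    by (simp_all add: x_def xexp_def rt_shift sec_shift del: rt_comp sec_comp)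
  have "fixes_to (x \<circ> t) (Suc (Suc (2 * n)))"
    using s F(2) by (intro fixes_to_Suc[OF s(1) s(2)[of 0]]) auto
  with x show ?case by auto
qed

text \<open>For a transposition of the first level: the depth to which the square of \<open>s\<close> fixes vertices below the
two vertices that are swapped.\<close>

definition swaps_to :: "(letter list \<Rightarrow> letter list) \<Rightarrow> nat \<Rightarrow> bool"
  where "swaps_to s n \<longleftrightarrow>
    (\<exists>c. rt s c \<noteq> c \<and> rt s (rt s c) = c \<and> fixes_to (sec s (rt s c) \<circ> sec s c) n)"

lemma swaps_to_unique:
  assumes s: "ta s" "swaps_to s m" "swaps_to s n"
  shows "m = n"
proof -
  obtain c where c: "rt s c \<noteq> c" "rt s (rt s c) = c" "fixes_to (sec s (rt s c) \<circ> sec s c) m"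
    using s(2) by (auto simp: swaps_to_def)
  obtain d where d: "rt s d \<noteq> d" "rt s (rt s d) = d" "fixes_to (sec s (rt s d) \<circ> sec s d) n"
    using s(3) by (auto simp: swaps_to_def)
  have "d = c \<or> d = rt s c"
  proof (rule ccontr)
    assume a: "\<not> (d = c \<or> d = rt s c)"
    have "rt s d \<noteq> c" "rt s d \<noteq> rt s c" using a c d by (auto simp: rt_inj[OF s(1)])
    then show False using a c(1) d(1)
      by (cases c; cases d; cases "rt s c"; cases "rt s d") simp_all
  qed
  then show ?thesis
  proof
    assume "d = c"
    then show ?thesis using c d s(1) by (auto intro: fixes_to_unique[of "sec s (rt s c) \<circ> sec s c"])
  next
    assume "d = rt s c"
    then have "fixes_to (sec s c \<circ> sec s (rt s c)) n" using d c by simp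
    moreover have "fixes_to (sec s c \<circ> (sec s (rt s c) \<circ> sec s c) \<circ> (sec s c)\<inverse>) m"
      using c s(1) by (intro fixes_to_conj) simp_all
    ultimately show ?thesis using s(1)
      by (intro fixes_to_unique[of "sec s c \<circ> sec s (rt s c)"]) (simp_all add: comp_assoc)
  qed
qed

lemma swaps_to_conj:
  assumes g: "ta g" and s: "ta s" "swaps_to s n"
  shows "swaps_to (g \<circ> s \<circ> g\<inverse>) n"
proof -
  obtain c where c: "rt s c \<noteq> c" "rt s (rt s c) = c" "fixes_to (sec s (rt s c) \<circ> sec s c) n"
    using s(2) by (auto simp: swaps_to_def)
  let ?t = "g \<circ> s \<circ> g\<inverse>"
  have r: "rt ?t (rt g d) = rt g (rt s d)" for d using g s by simp
  have e: "sec ?t (rt g d) = sec g (rt s d) \<circ> sec s d \<circ> (sec g d)\<inverse>" for d using g s by simp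
  have "fixes_to (sec g c \<circ> (sec s (rt s c) \<circ> sec s c) \<circ> (sec g c)\<inverse>) n"
    using c s g by (intro fixes_to_conj) simp_all
  moreover have "sec ?t (rt ?t (rt g c)) \<circ> sec ?t (rt g c)
      = sec g c \<circ> (sec s (rt s c) \<circ> sec s c) \<circ> (sec g c)\<inverse>"
    unfolding r e using g s c by (simp add: comp_assoc)
  ultimately show ?thesis unfolding swaps_to_def
    using c g r by (intro exI[of _ "rt g c"]) (simp add: rt_inj[OF g] del: rt_comp sec_comp)
qed

text \<open>Normalize \<open>t\<close> to act as \<open>c \<mapsto> -c\<close> on the first level, and let \<open>p\<close>, \<open>q\<close> be its sections at \<open>-1\<close> and \<open>1\<close>. For
\<open>y\<close> in the level stabilizer the square of \<open>y t\<close> has the section \<open>y\<^sub>1 (p y\<^sub>-\<^sub>1 p\<inverse>) (p q)\<close> at the vertex \<open>1\<close>.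
The product \<open>p q\<close> has both signs \<open>1\<close>, so \<open>fixes_to_even\<close> provides some \<open>h\<close> for which \<open>h (p q)\<close> has depth
\<open>n\<close>; it remains to write \<open>h\<close> as \<open>y\<^sub>1 (p y\<^sub>-\<^sub>1 p\<inverse>)\<close>.\<close>

lemma swaps_to_exists:
  assumes t: "normalizing t" "xsign t = -1" "gsign t = 1"
  shows "\<exists>x\<in>GS. swaps_to (x \<circ> t) n"
proof -
  let ?p = "sec t (-1)" and ?q = "sec t 1"
  have signs: "xsign ?p = -1" "gsign ?p = 1" "xsign ?q = -1" "gsign ?q = 1"
    using t by (simp_all add: sec_signs)
  have "normalizing (?p \<circ> ?q)" "xsign (?p \<circ> ?q) = 1" "gsign (?p \<circ> ?q) = 1"
    using t signs by (simp_all add: normalizing_comp xsign_comp gsign_comp)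
  then obtain h where h: "h \<in> GS" "fixes_to (h \<circ> (?p \<circ> ?q)) n" using fixes_to_even by blast
  \<comment> \<open>If \<open>gexp y\<^sub>-\<^sub>1 = 0\<close>, the relations between the exponents of \<open>y\<^sub>0\<close>, \<open>y\<^sub>1\<close>, \<open>y\<^sub>-\<^sub>1\<close> and the
      required product leave exactly this value for \<open>gexp y\<^sub>0\<close>.\<close>
  define b where "b = - (xexp h + gexp h)"
  have b: "xexp h + (gexp h - b) = b"
    by (cases "xexp h"; cases "gexp h") (simp_all add: b_def letter_defs)
  obtain w where w: "w \<in> GS" "xexp w = gexp h - b" "gexp w = 0" using GS_with_exps by blast
  obtain u where u: "u \<in> GS" "xexp u = - gexp h" "gexp u = b" using GS_with_exps by blast
  define k where "k = h \<circ> (?p \<circ> w\<inverse> \<circ> ?p\<inverse>)"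
  have "?p \<circ> w\<inverse> \<circ> ?p\<inverse> \<in> GS" using t w by (intro normalizing_conj) simp_all
  then have k: "k \<in> GS" "xexp k = b" "gexp k = gexp h"
    using h w t signs b by (simp_all add: k_def xexp_conj gexp_conj)
  define F where "F c = (if c = 0 then u else if c = 1 then k else w)" for c :: letter
  have F: "F c \<in> GS" for c using u k w by (simp add: F_def)
  have "branch F \<in> GS"
  proof (rule branch_GS[OF F])
    show "xexp (F c) = gexp (F (c - 1)) - gexp (F (c + 1))" for c
      using letter_cases[of c] u k w
      by (auto simp: F_def letter_distinct letter_double letter_double')
  qed
  define x where "x = branch F \<circ> lpow gs_x (- rt t 0)"
  have x: "x \<in> GS" using \<open>branch F \<in> GS\<close> by (simp add: x_def)
  have s: "rt (x \<circ> t) c = - c" "sec (x \<circ> t) c = F (- c) \<circ> sec t c" for c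
    using t \<open>branch F \<in> GS\<close> rt_affine[of t c]
    by (simp_all add: x_def xexp_def rt_shift sec_shift del: rt_comp sec_comp)
  have "sec (x \<circ> t) (rt (x \<circ> t) 1) \<circ> sec (x \<circ> t) 1 = h \<circ> (?p \<circ> ?q)"
    unfolding s using t w h by (simp add: F_def letter_distinct k_def comp_assoc)
  then have "swaps_to (x \<circ> t) n" unfolding swaps_to_def
    using h s by (intro exI[of _ 1]) (simp add: letter_distinct)
  with x show ?thesis by blast
qed

section \<open>Infinitely many twisted conjugacy classes\<close>

text \<open>Multiplying \<open>b = g a \<phi>(g\<inverse>)\<close> by \<open>t\<close> from the right gives \<open>b t = g (a t) g\<inverse>\<close>. The invariant \<open>J\<close> is a relation
rather than a function because the depth of fixed vertices may be infinite, and the factor \<open>k\<close>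
allows for depths that are reached only in steps.\<close>

lemma reidemeister_infinite:
  fixes J :: "(letter list \<Rightarrow> letter list) \<Rightarrow> nat \<Rightarrow> bool"
  assumes phi: "aut \<phi>" and t: "ta t" "\<And>g. g \<in> GS \<Longrightarrow> \<phi> g = t \<circ> g \<circ> t\<inverse>"
    and conj: "\<And>g s n. ta g \<Longrightarrow> ta s \<Longrightarrow> J s n \<Longrightarrow> J (g \<circ> s \<circ> g\<inverse>) n"
    and unique: "\<And>s m n. ta s \<Longrightarrow> J s m \<Longrightarrow> J s n \<Longrightarrow> m = n"
    and ex: "\<And>n. \<exists>x\<in>GS. J (x \<circ> t) (k * n)" and k: "k > 0"
  shows "reidemeister_number gupta_sidki \<phi> = \<infinity>"
proof -
  obtain x where x: "\<And>n. x n \<in> GS" "\<And>n. J (x n \<circ> t) (k * n)" using ex by metis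
  have eq: "equiv GS (twisted_conj gupta_sidki \<phi>)"
    using phi by (intro equiv_twisted_conj group_gupta_sidki) (simp add: iso_def)
  have "inj (\<lambda>n. twisted_conj gupta_sidki \<phi> `` {x n})"
  proof (rule injI)
    fix m n assume "twisted_conj gupta_sidki \<phi> `` {x m} = twisted_conj gupta_sidki \<phi> `` {x n}"
    then have "(x m, x n) \<in> twisted_conj gupta_sidki \<phi>"
      using eq x(1) by (simp add: eq_equiv_class_iff)
    then obtain g where g: "g \<in> GS" "x n = g \<circ> x m \<circ> \<phi> (g\<inverse>)"
      by (auto simp: twisted_conj_def)
    then have "x n \<circ> t = g \<circ> (x m \<circ> t) \<circ> g\<inverse>" using t by (simp add: comp_assoc)
    then have "J (x n \<circ> t) (k * m)" using conj[of g "x m \<circ> t"] g x t by simp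
    then have "k * m = k * n" using unique[of "x n \<circ> t" "k * m" "k * n"] x t by simp
    with k show "m = n" by simp
  qed
  then have "infinite (range (\<lambda>n. twisted_conj gupta_sidki \<phi> `` {x n}))"
    by (simp add: range_inj_infinite)
  moreover have "range (\<lambda>n. twisted_conj gupta_sidki \<phi> `` {x n}) \<subseteq> reidemeister_classes gupta_sidki \<phi>"
    using x(1) by (auto simp: reidemeister_classes_def quotient_def)
  ultimately show ?thesis
    by (auto simp: reidemeister_number_def dest: finite_subset)
qed

theorem theorem8p1:
  fixes \<phi> :: "(letter list \<Rightarrow> letter list) \<Rightarrow> (letter list \<Rightarrow> letter list)"
  assumes "\<phi> \<in> iso gupta_sidki gupta_sidki"
  shows "reidemeister_number gupta_sidki \<phi> = \<infinity>"
proof -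
  obtain t where t: "ta t" "\<And>g. g \<in> GS \<Longrightarrow> \<phi> g = t \<circ> g \<circ> t\<inverse>"
    using aut_is_conjugation[OF assms] by blast
  have "\<phi> g \<in> GS" if "g \<in> GS" for g using assms that by simp
  then have n: "normalizing t" using t by (simp add: normalizing_def)
  consider "xsign t = 1" "gsign t = 1" | "xsign t = 1" "gsign t = -1"
    | "xsign t = -1" "gsign t = -1" | "xsign t = -1" "gsign t = 1"
    using xsign_cases[OF t(1)] gsign_cases[OF n] by blast
  then show ?thesis
  proof cases
    case 1
    then have "\<exists>x\<in>GS. fixes_to (x \<circ> t) (1 * m)" for m using n by (simp add: fixes_to_even)
    then show ?thesis using fixes_to_conj fixes_to_unique
      by (intro reidemeister_infinite[where J = fixes_to and k = 1, OF assms t]) auto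
  next
    case 2
    then have "\<exists>x\<in>GS. fixes_to (x \<circ> t) (2 * m)" for m using n by (rule fixes_to_alternating[rotated])
    then show ?thesis using fixes_to_conj fixes_to_unique
      by (intro reidemeister_infinite[where J = fixes_to and k = 2, OF assms t]) auto
  next
    case 3
    then have "\<exists>x\<in>GS'. fixes_to (x \<circ> t) (Suc (2 * m))" for m
      using n by (intro fixes_to_reflect fixes_to_alternating) (simp_all add: sec_signs)
    then have "\<exists>x\<in>GS. fixes_to (x \<circ> t) (Suc (2 * m))" for m by (meson GS'_GS)
    moreover have "m = k" if "ta s" "fixes_to s (Suc m)" "fixes_to s (Suc k)" for s m k
      using fixes_to_unique[OF that] by simp
    ultimately show ?thesis using fixes_to_conj
      by (intro reidemeister_infinite[where J = "\<lambda>s n. fixes_to s (Suc n)" and k = 2, OF assms t]) auto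
  next
    case 4
    then have "\<exists>x\<in>GS. swaps_to (x \<circ> t) (1 * m)" for m using n by (simp add: swaps_to_exists)
    then show ?thesis using swaps_to_conj swaps_to_unique
      by (intro reidemeister_infinite[where J = swaps_to and k = 1, OF assms t]) auto
  qed
qed

end
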